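(* Let $F$ be a non-archimedean local field, $G$ a connected reductive affine algebraic $F$-group, $A\subset G$ a maximal $F$-split torus, and $\widetilde W=\Lambda\rtimes W_\circ(\Sigma)=W_{\mathrm{aff}}(\Sigma)\rtimes\Omega$ the corresponding Iwahori–Weyl group, with set of simple affine reflections $\Delta_{\mathrm{aff}}$ and length function $\ell$. Let $w\in\widetilde W$. If $w\notin\Lambda$, then there exist $s\in\Delta_{\mathrm{aff}}$, an integer $n\ge 0$ and $s_1,\dots,s_n\in\Delta_{\mathrm{aff}}$ such that, setting $w'=s_n\cdots s_1\,w\,s_1\cdots s_n$ (so $w'=w$ if $n=0$): (i) $\ell(s_i\cdots s_1\,w\,s_1\cdots s_i)=\ell(w)$ for all $1\le i\le n$; (ii) $\ell(sw')>\ell(w')$ and $\ell(w's)>\ell(w')$; (iii) $sw's\neq w'$.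
   Context: Setting. $M=C_G(A)$ is a minimal $F$-Levi subgroup; $M(F)_1$ is the kernel of the Kottwitz homomorphism $\kappa_M:M(F)\to\Omega_M= X^*(Z(\widehat M)^{I_F})^{\mathrm{Frob}}$ (a surjection onto a finitely generated abelian group; $I_F$ is the inertia group). The Iwahori–Weyl group of $(G,A)$ is $\widetilde W=N_G(A)(F)/M(F)_1$. It acts by affine transformations on the real vector space $\mathcal V=X_*(A)\otimes_{\mathbf Z}\mathbf R$ (the Bruhat–Tits action on the enlarged apartment). Known structure (may be used as given). By Bruhat–Tits there is a reduced root system $\Sigma$ (the échelonnage root system; possibly empty or reducible) such that the affine Weyl group $W_{\mathrm{aff}}(\Sigma)$, generated by the reflections in the affine root hyperplanes (null-sets of $\alpha+k$, $\alpha\in\Sigma$, $k\in\mathbf Z$), is a normal subgroup of $\widetilde W$. Fix an alcove (connected component of the complement of all affine root hyperplanes) in $\mathcal V$ with a special point in its closure. $\Delta_{\mathrm{aff}}$ is the set of reflections in the walls of this base alcove, a Coxeter generating set of $W_{\mathrm{aff}}(\Sigma)$, and $W_\circ(\Sigma)$, the finite Weyl group of $\Sigma$, is identified with the subgroup of $W_{\mathrm{aff}}(\Sigma)$ fixing the special point. $\Lambda\subset\widetilde W$ is the subgroup of all elements that act on $\mathcal V$ by translations; it is identified with $\Omega_M$, is a finitely generated abelian group (possibly with torsion, and possibly with non-identity elements acting trivially), and $\widetilde W=\Lambda\rtimes W_\circ(\Sigma)$. The quotient $\Omega=\widetilde W/W_{\mathrm{aff}}(\Sigma)$ is a finitely generated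 abelian group and is identified with the subgroup of elements of $\widetilde W$ stabilizing the base alcove, so that $\widetilde W=W_{\mathrm{aff}}(\Sigma)\rtimes\Omega$. The length function $\ell$ is the Coxeter length on $(W_{\mathrm{aff}}(\Sigma),\Delta_{\mathrm{aff}})$, extended to $\widetilde W$ by $\ell(w\tau)=\ell(w)$ for $w\in W_{\mathrm{aff}}(\Sigma)$, $\tau\in\Omega$. *)

theory Defs
  imports
    "HOL-Analysis.Analysis"
    "HOL-Algebra.Algebraic_Closure_Type"
    "HOL-Algebra.Generated_Groups"
    "HOL-Algebra.Group_Action"
    "HOL-Computational_Algebra.Polynomial"
begin

section \<open>Non-archimedean local fields\<close>

text \<open>The normalized discrete valuation is integer valued; its value at \<open>0\<close> (which should be
  infinity) is irrelevant and never used.\<close>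

definition val_ge :: "('f::field \<Rightarrow> int) \<Rightarrow> 'f \<Rightarrow> int \<Rightarrow> bool" where
  "val_ge val x N \<longleftrightarrow> x = 0 \<or> val x \<ge> N"

definition nonarch_local_field :: "('f::field \<Rightarrow> int) \<Rightarrow> bool" where
  "nonarch_local_field val \<longleftrightarrow>
     (\<forall>x y. x \<noteq> 0 \<longrightarrow> y \<noteq> 0 \<longrightarrow> val (x * y) = val x + val y) \<and>
     (\<forall>x y N. val_ge val x N \<longrightarrow> val_ge val y N \<longrightarrow> val_ge val (x + y) N) \<and>
     (\<exists>x. x \<noteq> 0 \<and> val x = 1) \<and>
     (\<forall>u :: nat \<Rightarrow> 'f.
        (\<forall>N. \<exists>k. \<forall>m\<ge>k. \<forall>n\<ge>k. val_ge val (u m - u n) N) \<longrightarrow>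
        (\<exists>x. \<forall>N. \<exists>k. \<forall>n\<ge>k. val_ge val (u n - x) N)) \<and>
     (\<exists>S. finite S \<and> (\<forall>x. val_ge val x 0 \<longrightarrow> (\<exists>r\<in>S. val_ge val (x - r) 1)))"


section \<open>Linear algebraic groups\<close>

text \<open>An affine algebraic group over a field \<open>F\<close> is a Zariski closed subgroup, defined over \<open>F\<close>,
  of the general linear group over the algebraic closure \<open>'f alg_closure\<close> of \<open>F\<close>. In the first
  definitions \<open>'k\<close> is meant to be algebraically closed (in particular infinite, so that
  polynomials and polynomial functions agree).\<close>

inductive_set poly_fun :: "'k::field set \<Rightarrow> ('k^'n^'n \<Rightarrow> 'k) set" for S :: "'k set" where
  const: "c \<in> S \<Longrightarrow> (\<lambda>_. c) \<in> poly_fun S"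
| entry: "(\<lambda>g. g $ i $ j) \<in> poly_fun S"
| add: "p \<in> poly_fun S \<Longrightarrow> q \<in> poly_fun S \<Longrightarrow> (\<lambda>g. p g + q g) \<in> poly_fun S"
| mult: "p \<in> poly_fun S \<Longrightarrow> q \<in> poly_fun S \<Longrightarrow> (\<lambda>g. p g * q g) \<in> poly_fun S"

definition zariski_closed :: "('k::field^'n^'n) set \<Rightarrow> bool" where
  "zariski_closed Z \<longleftrightarrow> (\<exists>P \<subseteq> poly_fun UNIV. Z = {g. \<forall>p\<in>P. p g = 0})"

definition zariski_connected :: "('k::field^'n^'n) set \<Rightarrow> bool" where
  "zariski_connected G \<longleftrightarrow>
     \<not> (\<exists>Z Y. zariski_closed Z \<and> zariski_closed Y \<and> G \<subseteq> Z \<union> Y \<and>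
          G \<inter> Z \<noteq> {} \<and> G \<inter> Y \<noteq> {} \<and> G \<inter> Z \<inter> Y = {})"

definition closed_subgroup_GL :: "('k::field^'n^'n) set \<Rightarrow> bool" where
  "closed_subgroup_GL G \<longleftrightarrow>
     (\<exists>Z. zariski_closed Z \<and> G = {g\<in>Z. invertible g}) \<and>
     mat 1 \<in> G \<and> (\<forall>g\<in>G. \<forall>h\<in>G. g ** h \<in> G) \<and> (\<forall>g\<in>G. matrix_inv g \<in> G)"

definition vanishing :: "'k::field set \<Rightarrow> ('k^'n^'n) set \<Rightarrow> ('k^'n^'n \<Rightarrow> 'k) set" where
  "vanishing S Z = {p \<in> poly_fun S. \<forall>g\<in>Z. p g = 0}"

text \<open>\<open>Z\<close> is defined over the subfield \<open>S\<close> if its full vanishing ideal is spanned by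
  polynomials with coefficients in \<open>S\<close>; for imperfect \<open>S\<close> this is stronger than being the zero
  set of such polynomials.\<close>

definition defined_over :: "'k::field set \<Rightarrow> ('k^'n^'n) set \<Rightarrow> bool" where
  "defined_over S Z \<longleftrightarrow>
     (\<forall>p \<in> vanishing UNIV Z. \<exists>Q c. finite Q \<and> Q \<subseteq> vanishing S Z \<and>
        p = (\<lambda>g. \<Sum>q\<in>Q. c q * q g))"

definition unipotent :: "'k::field^'n^'n \<Rightarrow> bool" where
  "unipotent g \<longleftrightarrow> (\<exists>m. (((**) (g - mat 1)) ^^ m) (mat 1) = 0)"

definition connected_reductive :: "('k::field^'n^'n) set \<Rightarrow> bool" where
  "connected_reductive G \<longleftrightarrow>
     closed_subgroup_GL G \<and> zariski_connected G \<and>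
     (\<forall>U \<subseteq> G. closed_subgroup_GL U \<and> zariski_connected U \<and> (\<forall>u\<in>U. unipotent u) \<and>
        (\<forall>g\<in>G. \<forall>u\<in>U. g ** u ** matrix_inv g \<in> U) \<longrightarrow> U = {mat 1})"

abbreviation base_field :: "'f::field alg_closure set" where
  "base_field \<equiv> range to_ac"

definition rational_points :: "('f::field alg_closure^'n^'n) set \<Rightarrow> ('f alg_closure^'n^'n) set"
  where "rational_points Z = {g \<in> Z. \<forall>i j. g $ i $ j \<in> base_field}"

definition split_torus :: "('f::field alg_closure^'n^'n) set \<Rightarrow> bool" where
  "split_torus A \<longleftrightarrow>
     closed_subgroup_GL A \<and> zariski_connected A \<and> defined_over base_field A \<and>
     (\<exists>P \<in> rational_points {P. invertible P}.
        \<forall>a\<in>A. \<forall>i j. i \<noteq> j \<longrightarrow> (P ** a ** matrix_inv P) $ i $ j = 0)"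

definition maximal_split_torus ::
    "('f::field alg_closure^'n^'n) set \<Rightarrow> ('f alg_closure^'n^'n) set \<Rightarrow> bool" where
  "maximal_split_torus G A \<longleftrightarrow>
     A \<subseteq> G \<and> split_torus A \<and> (\<forall>T. split_torus T \<longrightarrow> A \<subseteq> T \<longrightarrow> T \<subseteq> G \<longrightarrow> T = A)"

definition centralizer_in :: "('k::field^'n^'n) set \<Rightarrow> ('k^'n^'n) set \<Rightarrow> ('k^'n^'n) set" where
  "centralizer_in G A = {g \<in> G. \<forall>a\<in>A. g ** a = a ** g}"

definition normalizer_in :: "('k::field^'n^'n) set \<Rightarrow> ('k^'n^'n) set \<Rightarrow> ('k^'n^'n) set" where
  "normalizer_in G A = {g \<in> G. (\<lambda>a. g ** a ** matrix_inv g) ` A = A}"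

definition matrix_group :: "('k::field^'n^'n) set \<Rightarrow> ('k^'n^'n) monoid" where
  "matrix_group Z = \<lparr>carrier = Z, mult = (**), one = mat 1\<rparr>"

text \<open>The groups \<open>M(F)\<close>, for \<open>M\<close> the centralizer of \<open>A\<close>, and \<open>N\<^sub>G(A)(F)\<close>.\<close>

definition levi_points ::
    "('f::field alg_closure^'n^'n) set \<Rightarrow> ('f alg_closure^'n^'n) set \<Rightarrow> ('f alg_closure^'n^'n) monoid"
  where "levi_points G A = matrix_group (rational_points (centralizer_in G A))"

definition normalizer_points ::
    "('f::field alg_closure^'n^'n) set \<Rightarrow> ('f alg_closure^'n^'n) set \<Rightarrow> ('f alg_closure^'n^'n) monoid"
  where "normalizer_points G A = matrix_group (rational_points (normalizer_in G A))"

text \<open>Cocharacters are functions on the units of \<open>'k\<close>; they are normalized by the value \<open>0\<close>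
  at \<open>0\<close> so that equal cocharacters are equal as functions on the whole type.\<close>

definition cocharacters :: "('k::field^'n^'n) set \<Rightarrow> ('k \<Rightarrow> 'k^'n^'n) set" where
  "cocharacters A =
     {c. c 0 = 0 \<and> (\<forall>t. t \<noteq> 0 \<longrightarrow> c t \<in> A) \<and>
         (\<forall>s t. s \<noteq> 0 \<longrightarrow> t \<noteq> 0 \<longrightarrow> c (s * t) = c s ** c t) \<and>
         (\<forall>i j. \<exists>(p :: 'k poly) (m :: nat). \<forall>t. t \<noteq> 0 \<longrightarrow> c t $ i $ j = poly p t / t ^ m)}"

definition characters_over ::
    "'k::field set \<Rightarrow> ('k^'n^'n) set \<Rightarrow> ('k^'n^'n \<Rightarrow> 'k) set" where
  "characters_over S M =
     {\<psi>. (\<forall>g\<in>M. \<psi> g \<noteq> 0) \<and> (\<forall>g\<in>M. \<forall>h\<in>M. \<psi> (g ** h) = \<psi> g * \<psi> h) \<and>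
         (\<exists>p\<in>poly_fun S. \<exists>m::nat. \<forall>g\<in>M. \<psi> g = p g / det g ^ m)}"


section \<open>The Iwahori--Weyl group and its action\<close>

definition finitely_generated :: "('a, 'b) monoid_scheme \<Rightarrow> bool" where
  "finitely_generated G \<longleftrightarrow> (\<exists>S. finite S \<and> S \<subseteq> carrier G \<and> generate G S = carrier G)"

text \<open>The formal properties of the Kottwitz homomorphism \<open>\<kappa>\<close> of the minimal Levi subgroup: it
  is a surjection of \<open>M(F)\<close> onto a finitely generated abelian group, and its kernel is normal
  in \<open>N\<^sub>G(A)(F)\<close>, so that the Iwahori--Weyl group makes sense.\<close>

definition kottwitz_hom ::
    "('f::field alg_closure^'n^'n) set \<Rightarrow> ('f alg_closure^'n^'n) set \<Rightarrow> 'o monoid \<Rightarrow>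
     ('f alg_closure^'n^'n \<Rightarrow> 'o) \<Rightarrow> bool" where
  "kottwitz_hom G A OmM \<kappa> \<longleftrightarrow>
     comm_group OmM \<and> finitely_generated OmM \<and>
     \<kappa> \<in> hom (levi_points G A) OmM \<and> \<kappa> ` carrier (levi_points G A) = carrier OmM \<and>
     kernel (levi_points G A) OmM \<kappa> \<lhd> normalizer_points G A"

definition kottwitz_coset ::
    "('f::field alg_closure^'n^'n) set \<Rightarrow> ('f alg_closure^'n^'n) set \<Rightarrow> 'o monoid \<Rightarrow>
     ('f alg_closure^'n^'n \<Rightarrow> 'o) \<Rightarrow> 'f alg_closure^'n^'n \<Rightarrow> ('f alg_closure^'n^'n) set" where
  "kottwitz_coset G A OmM \<kappa> n =
     kernel (levi_points G A) OmM \<kappa> #>\<^bsub>normalizer_points G A\<^esub> n"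

definition iwahori_weyl_group ::
    "('f::field alg_closure^'n^'n) set \<Rightarrow> ('f alg_closure^'n^'n) set \<Rightarrow> 'o monoid \<Rightarrow>
     ('f alg_closure^'n^'n \<Rightarrow> 'o) \<Rightarrow> ('f alg_closure^'n^'n) set monoid" where
  "iwahori_weyl_group G A OmM \<kappa> =
     normalizer_points G A Mod kernel (levi_points G A) OmM \<kappa>"

text \<open>\<open>\<iota>\<close> realizes the type \<open>'v\<close> as the tensor product of \<open>X\<^sub>*(A)\<close> with the reals: it identifies
  \<open>X\<^sub>*(A)\<close> with the lattice spanned by a basis of the finite-dimensional space \<open>'v\<close>. The type class
  \<open>real_inner\<close> (rather than \<open>euclidean_space\<close>) allows dimension zero, that is, trivial \<open>A\<close>.\<close>

definition cocharacter_space ::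
    "('k::field^'n^'n) set \<Rightarrow> (('k \<Rightarrow> 'k^'n^'n) \<Rightarrow> 'v::real_inner) \<Rightarrow> bool" where
  "cocharacter_space A \<iota> \<longleftrightarrow>
     inj_on \<iota> (cocharacters A) \<and>
     (\<forall>c\<in>cocharacters A. \<forall>d\<in>cocharacters A. \<iota> (\<lambda>t. c t ** d t) = \<iota> c + \<iota> d) \<and>
     (\<exists>B. finite B \<and> independent B \<and> span B = UNIV \<and>
        \<iota> ` cocharacters A = {\<Sum>b\<in>B. of_int (m b) *\<^sub>R b | m :: 'v \<Rightarrow> int. True})"

text \<open>The Bruhat--Tits action of \<open>N\<^sub>G(A)(F)\<close> on the enlarged apartment, which factors through the
  Iwahori--Weyl group: an affine action whose linear part is conjugation on \<open>X\<^sub>*(A)\<close> and under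
  which \<open>m \<in> M(F)\<close> translates by the vector \<open>\<nu>(m)\<close> with \<open>\<langle>\<psi>, \<nu>(m)\<rangle> = - val (\<psi>(m))\<close> for all
  \<open>F\<close>-rational characters \<open>\<psi>\<close> of \<open>M\<close>. The functional \<open>f\<close> is the extension to \<open>'v\<close> of the
  pairing of the restriction of \<open>\<psi>\<close> to \<open>A\<close> with cocharacters.\<close>

definition bruhat_tits_action ::
    "('f::field \<Rightarrow> int) \<Rightarrow> ('f alg_closure^'n^'n) set \<Rightarrow> ('f alg_closure^'n^'n) set \<Rightarrow>
     'o monoid \<Rightarrow> ('f alg_closure^'n^'n \<Rightarrow> 'o) \<Rightarrow>
     (('f alg_closure \<Rightarrow> 'f alg_closure^'n^'n) \<Rightarrow> 'v::real_inner) \<Rightarrow>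
     (('f alg_closure^'n^'n) set \<Rightarrow> 'v \<Rightarrow> 'v) \<Rightarrow> bool" where
  "bruhat_tits_action val G A OmM \<kappa> \<iota> act \<longleftrightarrow>
     group_action (iwahori_weyl_group G A OmM \<kappa>) UNIV act \<and>
     (\<forall>n \<in> carrier (normalizer_points G A). \<exists>L. linear L \<and>
        (\<forall>x. act (kottwitz_coset G A OmM \<kappa> n) x = L x + act (kottwitz_coset G A OmM \<kappa> n) 0) \<and>
        (\<forall>c\<in>cocharacters A. L (\<iota> c) = \<iota> (\<lambda>t. n ** c t ** matrix_inv n))) \<and>
     (\<forall>m \<in> carrier (levi_points G A).
        \<forall>\<psi> \<in> characters_over base_field (centralizer_in G A). \<forall>f :: 'v \<Rightarrow> real. \<forall>b.
        linear f \<longrightarrow>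
        (\<forall>c\<in>cocharacters A. \<exists>k::int. f (\<iota> c) = of_int k \<and> (\<forall>t. t \<noteq> 0 \<longrightarrow> \<psi> (c t) = t powi k)) \<longrightarrow>
        \<psi> m = to_ac b \<longrightarrow>
        (\<forall>x. f (act (kottwitz_coset G A OmM \<kappa> m) x - x) = - of_int (val b)))"


section \<open>Root systems and alcoves\<close>

text \<open>A root, a linear form on the apartment, is represented by its gradient with respect to an
  inner product on \<open>'v\<close> that is invariant under the finite Weyl group, so that the affine
  reflections of the root system are orthogonal reflections. The roots need not span.\<close>

definition affine_reflection :: "'v::real_inner \<Rightarrow> int \<Rightarrow> 'v \<Rightarrow> 'v" where
  "affine_reflection \<alpha> k x = x - (2 * (\<alpha> \<bullet> x + of_int k) / (\<alpha> \<bullet> \<alpha>)) *\<^sub>R \<alpha>"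

definition affine_hyperplane :: "'v::real_inner \<Rightarrow> int \<Rightarrow> 'v set" where
  "affine_hyperplane \<alpha> k = {x. \<alpha> \<bullet> x + of_int k = 0}"

definition reduced_root_system :: "'v::real_inner set \<Rightarrow> bool" where
  "reduced_root_system R \<longleftrightarrow>
     finite R \<and> 0 \<notin> R \<and>
     (\<forall>\<alpha>\<in>R. affine_reflection \<alpha> 0 ` R = R) \<and>
     (\<forall>\<alpha>\<in>R. \<forall>\<beta>\<in>R. 2 * (\<alpha> \<bullet> \<beta>) / (\<alpha> \<bullet> \<alpha>) \<in> \<int>) \<and>
     (\<forall>\<alpha>\<in>R. \<forall>c. c *\<^sub>R \<alpha> \<in> R \<longrightarrow> c = 1 \<or> c = -1)"

definition root_hyperplanes :: "'v::real_inner set \<Rightarrow> 'v set set" where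
  "root_hyperplanes R = {affine_hyperplane \<alpha> k | \<alpha> k. \<alpha> \<in> R}"

definition affine_weyl_transformations :: "'v::real_inner set \<Rightarrow> ('v \<Rightarrow> 'v) set" where
  "affine_weyl_transformations R =
     generate (BijGroup UNIV) {affine_reflection \<alpha> k | \<alpha> k. \<alpha> \<in> R}"

definition alcoves :: "'v::real_inner set \<Rightarrow> 'v set set" where
  "alcoves R = components (- \<Union>(root_hyperplanes R))"

definition walls :: "'v::real_inner set \<Rightarrow> 'v set \<Rightarrow> 'v set set" where
  "walls R C = {H \<in> root_hyperplanes R. affine hull (H \<inter> closure C) = H}"

definition special_point :: "'v::real_inner set \<Rightarrow> 'v \<Rightarrow> bool" where
  "special_point R x \<longleftrightarrow> (\<forall>\<alpha>\<in>R. \<exists>k. x \<in> affine_hyperplane \<alpha> k)"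


section \<open>Subgroups of the Iwahori--Weyl group and the length function\<close>

text \<open>In the following \<open>Waff\<close> is the copy of the affine Weyl group inside the Iwahori--Weyl group
  \<open>W\<close>. It is not determined by the action alone, which need not be faithful on \<open>W\<close>.\<close>

definition translation_subgroup :: "'w monoid \<Rightarrow> ('w \<Rightarrow> 'v \<Rightarrow> 'v::real_inner) \<Rightarrow> 'w set" where
  "translation_subgroup W act = {w \<in> carrier W. \<exists>v. \<forall>x. act w x = x + v}"

definition finite_weyl_group :: "('w \<Rightarrow> 'v \<Rightarrow> 'v) \<Rightarrow> 'w set \<Rightarrow> 'v \<Rightarrow> 'w set" where
  "finite_weyl_group act Waff x0 = {w \<in> Waff. act w x0 = x0}"

definition alcove_stabilizer :: "'w monoid \<Rightarrow> ('w \<Rightarrow> 'v \<Rightarrow> 'v) \<Rightarrow> 'v set \<Rightarrow> 'w set" where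
  "alcove_stabilizer W act C = {w \<in> carrier W. act w ` C = C}"

definition simple_affine_reflections ::
    "('w \<Rightarrow> 'v \<Rightarrow> 'v::real_inner) \<Rightarrow> 'w set \<Rightarrow> 'v set \<Rightarrow> 'v set \<Rightarrow> 'w set" where
  "simple_affine_reflections act Waff R C =
     {s \<in> Waff. \<exists>\<alpha>\<in>R. \<exists>k. affine_hyperplane \<alpha> k \<in> walls R C \<and> act s = affine_reflection \<alpha> k}"

definition word :: "'w monoid \<Rightarrow> 'w list \<Rightarrow> 'w" where
  "word W ss = foldr (mult W) ss \<one>\<^bsub>W\<^esub>"

definition word_length :: "'w monoid \<Rightarrow> 'w set \<Rightarrow> 'w \<Rightarrow> nat" where
  "word_length W S u = (LEAST n. \<exists>ss. length ss = n \<and> set ss \<subseteq> S \<and> u = word W ss)"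

definition iw_length ::
    "'w monoid \<Rightarrow> ('w \<Rightarrow> 'v \<Rightarrow> 'v::real_inner) \<Rightarrow> 'w set \<Rightarrow> 'v set \<Rightarrow> 'v set \<Rightarrow> 'w \<Rightarrow> nat" where
  "iw_length W act Waff R C w =
     word_length W (simple_affine_reflections act Waff R C)
       (THE u. u \<in> Waff \<and> (\<exists>\<tau> \<in> alcove_stabilizer W act C. w = u \<otimes>\<^bsub>W\<^esub> \<tau>))"

text \<open>For \<open>ss = [s\<^sub>1, \<dots>, s\<^sub>n]\<close> this is \<open>s\<^sub>n \<cdots> s\<^sub>1 w s\<^sub>1 \<cdots> s\<^sub>n\<close>.\<close>

definition conj_word :: "'w monoid \<Rightarrow> 'w list \<Rightarrow> 'w \<Rightarrow> 'w" where
  "conj_word W ss w = word W (rev ss) \<otimes>\<^bsub>W\<^esub> w \<otimes>\<^bsub>W\<^esub> word W ss"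

definition semidirect :: "'w monoid \<Rightarrow> 'w set \<Rightarrow> 'w set \<Rightarrow> bool" where
  "semidirect W N H \<longleftrightarrow>
     N \<lhd> W \<and> subgroup H W \<and> N \<inter> H = {\<one>\<^bsub>W\<^esub>} \<and> N <#>\<^bsub>W\<^esub> H = carrier W"

text \<open>The structure on the Iwahori--Weyl group provided by Bruhat and Tits: the reduced root system
  \<open>R\<close>, the affine Weyl group, a base alcove \<open>C\<close> and a special point \<open>x0\<close> in its closure, the two
  semidirect product decompositions, and the generation of the affine Weyl group by the simple
  affine reflections.\<close>

locale iwahori_weyl_structure =
  fixes W :: "'w monoid"
    and act :: "'w \<Rightarrow> 'v \<Rightarrow> 'v::real_inner"
    and Waff :: "'w set" and R :: "'v set" and C :: "'v set" and x0 :: 'v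
  assumes action: "group_action W UNIV act"
    and root_system: "reduced_root_system R"
    and Waff_normal: "Waff \<lhd> W"
    and Waff_iso: "bij_betw act Waff (affine_weyl_transformations R)"
    and base_alcove: "C \<in> alcoves R"
    and base_point: "x0 \<in> closure C" "special_point R x0"
    and simple_generate: "generate W (simple_affine_reflections act Waff R C) = Waff"
    and translations_abelian: "comm_group (W\<lparr>carrier := translation_subgroup W act\<rparr>)"
    and translations_fg: "finitely_generated (W\<lparr>carrier := translation_subgroup W act\<rparr>)"
    and decomp_translations:
      "semidirect W (translation_subgroup W act) (finite_weyl_group act Waff x0)"
    and quotient_abelian: "comm_group (W Mod Waff)"
    and quotient_fg: "finitely_generated (W Mod Waff)"
    and decomp_stabilizer: "semidirect W Waff (alcove_stabilizer W act C)"

end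

theory Submission
  imports Defs
begin

text \<open>Let \<open>F\<^sub>w y = \<bar>w y - y\<bar>\<^sup>2\<close> on the apartment; half of its gradient is
  \<open>G\<^sub>w y = 2 y - w y - w\<inverse> y\<close>. If no conjugate \<open>w'\<close> of \<open>w\<close> that is reached by length-preserving
  conjugations with simple reflections has its length raised by a further one, then at a point
  \<open>y\<close> of the wall of \<open>s\<close> where \<open>G\<^sub>w\<^sub>' y\<close> points out of the alcove, \<open>w'\<close> or its inverse keeps the
  alcove on its side of that wall, so that \<open>s w' s\<close> is again reached. Moreover \<open>s w' s\<close> has the
  same displacement at \<open>y\<close>, and its gradient there is the mirror image, closer to
  the alcove. Choose \<open>w'\<close> among the finitely many reached elements and \<open>y\<close> in the closed alcove
  with maximal displacement, and then, for this \<open>y\<close>, choose \<open>w'\<close> with the gradient pointing best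
  into the alcove. Then one can move from \<open>y\<close> along the gradient inside the closed alcove, which
  by convexity of the displacement contradicts maximality unless the gradient vanishes. In that
  case the displacement is minimal at \<open>y\<close> as well, so it is constant and \<open>w'\<close> is a
  translation.\<close>

section \<open>Orthogonal reflections and rigid motions\<close>

text \<open>The offset is real: the image of a root hyperplane under a rigid motion need not come
  with an integral one. Offset 0 gives the linear part.\<close>

definition reflection :: "'v::real_inner \<Rightarrow> real \<Rightarrow> 'v \<Rightarrow> 'v" where
  "reflection \<alpha> k x = x - (2 * (\<alpha> \<bullet> x + k) / (\<alpha> \<bullet> \<alpha>)) *\<^sub>R \<alpha>"

lemma affine_reflection_eq: "affine_reflection \<alpha> k = reflection \<alpha> (of_int k)"
  by (rule ext) (simp add: affine_reflection_def reflection_def)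

lemma inner_reflection: "\<alpha> \<noteq> 0 \<Longrightarrow> \<alpha> \<bullet> reflection \<alpha> k x + k = - (\<alpha> \<bullet> x + k)"
  by (simp add: reflection_def inner_diff_right)

lemma reflection_involutive: "\<alpha> \<noteq> 0 \<Longrightarrow> reflection \<alpha> k (reflection \<alpha> k x) = x"
proof -
  assume "\<alpha> \<noteq> 0"
  then have "reflection \<alpha> k (reflection \<alpha> k x) = reflection \<alpha> k x + (2 * (\<alpha> \<bullet> x + k) / (\<alpha> \<bullet> \<alpha>)) *\<^sub>R \<alpha>"
    by (subst reflection_def)
      (simp only: inner_reflection[OF \<open>\<alpha> \<noteq> 0\<close>] mult_minus_right minus_divide_left[symmetric] scaleR_minus_left diff_minus_eq_add)
  then show ?thesis by (simp add: reflection_def)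
qed

lemma reflection_fixes: "\<alpha> \<bullet> x + k = 0 \<Longrightarrow> reflection \<alpha> k x = x"
  by (simp add: reflection_def)

lemma reflection_scale:
  assumes "c \<noteq> 0"
  shows "reflection (c *\<^sub>R \<alpha>) (c * k) = reflection \<alpha> k"
proof
  fix x
  have "2 * ((c *\<^sub>R \<alpha>) \<bullet> x + c * k) / ((c *\<^sub>R \<alpha>) \<bullet> (c *\<^sub>R \<alpha>)) * c = 2 * (\<alpha> \<bullet> x + k) / (\<alpha> \<bullet> \<alpha>)"
    using assms by (cases "\<alpha> = 0") (simp_all add: field_simps)
  then show "reflection (c *\<^sub>R \<alpha>) (c * k) x = reflection \<alpha> k x"
    unfolding reflection_def by (metis scaleR_scaleR)
qed

text \<open>A form that is constant on a hyperplane vanishes on the directions orthogonal to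
  \<alpha>, so \<beta> is a multiple of \<alpha>. Evaluating at the foot \<open>p\<close> of the
  perpendicular from the origin gives the same factor for the offsets.\<close>

lemma reflection_eqI:
  assumes "\<alpha> \<noteq> 0" "\<beta> \<noteq> 0" and sub: "\<And>x. \<alpha> \<bullet> x + k = 0 \<Longrightarrow> \<beta> \<bullet> x + l = 0"
  shows "reflection \<alpha> k = reflection \<beta> l"
proof -
  define p where "p = (- k / (\<alpha> \<bullet> \<alpha>)) *\<^sub>R \<alpha>"
  define c where "c = (\<beta> \<bullet> \<alpha>) / (\<alpha> \<bullet> \<alpha>)"
  have aa: "\<alpha> \<bullet> \<alpha> \<noteq> 0" using assms(1) by simp
  have p: "\<alpha> \<bullet> p + k = 0" using aa by (simp add: p_def)
  have bp: "\<beta> \<bullet> p + l = 0" by (rule sub[OF p])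
  have "\<beta> \<bullet> z = (c *\<^sub>R \<alpha>) \<bullet> z" for z
  proof -
    have "\<alpha> \<bullet> (p + (z - ((\<alpha> \<bullet> z) / (\<alpha> \<bullet> \<alpha>)) *\<^sub>R \<alpha>)) + k = 0"
      using p aa by (simp add: inner_add_right inner_diff_right)
    from sub[OF this] bp show ?thesis
      by (simp add: inner_add_right inner_diff_right c_def) (simp add: algebra_simps)
  qed
  then have b: "\<beta> = c *\<^sub>R \<alpha>" by (metis vector_eq_rdot inner_commute)
  then have c: "c \<noteq> 0" using assms(2) by auto
  have "l = c * k" using bp p b
    by (simp add: inner_scaleR_left) (metis add.inverse_inverse add_eq_0_iff mult_minus_right)
  with b c show ?thesis by (simp add: reflection_scale)
qed

lemma linear_reflection: "linear (reflection \<alpha> 0)"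
  by (rule linearI)
    (simp_all add: reflection_def inner_add_right distrib_left add_divide_distrib scaleR_add_left scaleR_diff_right)

text \<open>The third clause matters when the roots do not span: displacements are then constant
  along directions orthogonal to all roots, in which the closed alcove is unbounded.\<close>

definition rigid_motion :: "'v::real_inner set \<Rightarrow> ('v \<Rightarrow> 'v) \<Rightarrow> bool" where
  "rigid_motion R g \<longleftrightarrow> (\<exists>L a. linear L \<and> (\<forall>x y. L x \<bullet> L y = x \<bullet> y) \<and>
     (\<forall>z. (\<forall>\<alpha>\<in>R. \<alpha> \<bullet> z = 0) \<longrightarrow> L z = z) \<and> (\<forall>x. g x = L x + a))"

lemma rigid_motionE:
  assumes "rigid_motion R g"
  obtains L a where "linear L" "\<And>x y. L x \<bullet> L y = x \<bullet> y"
    "\<And>z. (\<And>\<alpha>. \<alpha> \<in> R \<Longrightarrow> \<alpha> \<bullet> z = 0) \<Longrightarrow> L z = z" "\<And>x. g x = L x + a"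
proof -
  obtain L a where L: "linear L" "\<forall>x y. L x \<bullet> L y = x \<bullet> y"
    "\<forall>z. (\<forall>\<alpha>\<in>R. \<alpha> \<bullet> z = 0) \<longrightarrow> L z = z" "\<forall>x. g x = L x + a"
    using assms unfolding rigid_motion_def by blast
  show thesis by (rule that[of L a]) (use L in blast)+
qed

lemma rigid_motion_translation: "rigid_motion R (\<lambda>x. x + v)"
  unfolding rigid_motion_def by (intro exI[of _ "\<lambda>x. x"] exI[of _ v]) (simp add: linear_id[unfolded id_def])

lemma rigid_motion_comp:
  assumes "rigid_motion R g" "rigid_motion R h"
  shows "rigid_motion R (\<lambda>x. g (h x))"
proof -
  obtain L a where L: "linear L" "\<And>x y. L x \<bullet> L y = x \<bullet> y"
    "\<And>z. (\<And>\<alpha>. \<alpha> \<in> R \<Longrightarrow> \<alpha> \<bullet> z = 0) \<Longrightarrow> L z = z" "\<And>x. g x = L x + a"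
    using rigid_motionE[OF assms(1)] by blast
  obtain M b where M: "linear M" "\<And>x y. M x \<bullet> M y = x \<bullet> y"
    "\<And>z. (\<And>\<alpha>. \<alpha> \<in> R \<Longrightarrow> \<alpha> \<bullet> z = 0) \<Longrightarrow> M z = z" "\<And>x. h x = M x + b"
    using rigid_motionE[OF assms(2)] by blast
  have "g (h x) = L (M x) + (L b + a)" for x
    by (simp add: L(4) M(4) linear_add[OF L(1)] add.assoc)
  then show ?thesis unfolding rigid_motion_def
    using linear_compose[OF M(1) L(1)] L(2,3) M(2,3)
    by (intro exI[of _ "L \<circ> M"] exI[of _ "L b + a"]) auto
qed

lemma rigid_motion_reflection:
  assumes "\<alpha> \<in> R" "\<alpha> \<noteq> 0"
  shows "rigid_motion R (reflection \<alpha> k)"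
proof -
  have aa: "\<alpha> \<bullet> \<alpha> \<noteq> 0" using assms(2) by simp
  have "reflection \<alpha> 0 x \<bullet> reflection \<alpha> 0 y = x \<bullet> y" for x y
    using aa by (simp add: reflection_def inner_diff_left inner_diff_right inner_commute[of x \<alpha>] divide_simps)
  moreover have "reflection \<alpha> k x = reflection \<alpha> 0 x + reflection \<alpha> k 0" for x
    by (simp add: reflection_def distrib_left add_divide_distrib scaleR_add_left)
  moreover have "reflection \<alpha> 0 z = z" if "\<forall>\<beta>\<in>R. \<beta> \<bullet> z = 0" for z
    using that assms(1) by (simp add: reflection_fixes)
  ultimately show ?thesis unfolding rigid_motion_def using linear_reflection by blast
qed

lemma rigid_motion_dist:
  assumes "rigid_motion R g"
  shows "dist (g x) (g y) = dist x y"
proof -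
  obtain L a where L: "linear L" "\<And>x y. L x \<bullet> L y = x \<bullet> y" "\<And>x. g x = L x + a"
    using rigid_motionE[OF assms] by metis
  have "g x - g y = L (x - y)"
    by (simp add: L(3) linear_diff[OF L(1)])
  then show ?thesis by (simp add: dist_norm norm_eq_sqrt_inner L(2))
qed

lemma rigid_motion_continuous: "rigid_motion R g \<Longrightarrow> continuous_on Y g"
  unfolding continuous_on_iff by (metis rigid_motion_dist)

lemma rigid_motion_reflection_conj:
  assumes g: "rigid_motion R g" and "\<alpha> \<noteq> 0"
  obtains \<beta> l where "\<beta> \<noteq> 0" "\<And>x. \<beta> \<bullet> g x + l = \<alpha> \<bullet> x + k"
    "\<And>x. g (reflection \<alpha> k x) = reflection \<beta> l (g x)"
proof -
  obtain L a where L: "linear L" "\<And>x y. L x \<bullet> L y = x \<bullet> y" "\<And>x. g x = L x + a"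
    using rigid_motionE[OF assms(1)] by metis
  define l where "l = k - L \<alpha> \<bullet> a"
  have 1: "L \<alpha> \<bullet> g x + l = \<alpha> \<bullet> x + k" for x
    by (simp add: l_def inner_add_right L(2,3))
  have 2: "g (reflection \<alpha> k x) = reflection (L \<alpha>) l (g x)" for x
  proof -
    have "g (reflection \<alpha> k x) = L (reflection \<alpha> k x) + a" by (rule L(3))
    also have "L (reflection \<alpha> k x) = L x - (2 * (\<alpha> \<bullet> x + k) / (\<alpha> \<bullet> \<alpha>)) *\<^sub>R L \<alpha>"
      by (simp only: reflection_def linear_diff[OF L(1)] linear_scale[OF L(1)])
    also have "\<dots> + a = reflection (L \<alpha>) l (g x)"
      using 1[of x] L(3)[of x] L(2)[of \<alpha> \<alpha>] by (simp add: reflection_def)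
    finally show ?thesis .
  qed
  have "L \<alpha> \<noteq> 0" using L(2)[of \<alpha> \<alpha>] assms(2) by auto
  then show ?thesis using 1 2 that by blast
qed

section \<open>Finiteness, compactness and maxima\<close>

lemma finite_generating_words:
  assumes "finite S"
  shows "finite {word W ss | ss. set ss \<subseteq> S \<and> length ss = n}"
  using finite_lists_length_eq[OF assms, of n] by (simp add: setcompr_eq_image)

text \<open>In an arbitrary inner product space closed bounded sets need not be compact, so the box
  is built by induction as a continuous image of an interval times a smaller box.\<close>

lemma compact_box:
  fixes B :: "'v::real_inner set"
  assumes "finite B"
  shows "compact {\<Sum>b\<in>B. f b *\<^sub>R b | f. \<forall>b\<in>B. \<bar>f b\<bar> \<le> M b}"
  using assms
proof (induction B)
  case empty
  then show ?case by simp
next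
  case (insert a B)
  let ?K = "{\<Sum>b\<in>B. f b *\<^sub>R b | f. \<forall>b\<in>B. \<bar>f b\<bar> \<le> M b}"
  let ?p = "\<lambda>(t, x). t *\<^sub>R a + x"
  have "{\<Sum>b\<in>insert a B. f b *\<^sub>R b | f. \<forall>b\<in>insert a B. \<bar>f b\<bar> \<le> M b} = ?p ` ({- M a..M a} \<times> ?K)"
  proof (intro equalityI subsetI)
    fix x assume "x \<in> {\<Sum>b\<in>insert a B. f b *\<^sub>R b | f. \<forall>b\<in>insert a B. \<bar>f b\<bar> \<le> M b}"
    then obtain f where "x = f a *\<^sub>R a + (\<Sum>b\<in>B. f b *\<^sub>R b)" "\<forall>b\<in>insert a B. \<bar>f b\<bar> \<le> M b"
      using insert.hyps by auto
    then show "x \<in> ?p ` ({- M a..M a} \<times> ?K)"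
      by (intro image_eqI[of _ _ "(f a, \<Sum>b\<in>B. f b *\<^sub>R b)"]) (auto simp: abs_le_iff)
  next
    fix x assume "x \<in> ?p ` ({- M a..M a} \<times> ?K)"
    then obtain t f where f: "x = t *\<^sub>R a + (\<Sum>b\<in>B. f b *\<^sub>R b)" "\<bar>t\<bar> \<le> M a" "\<forall>b\<in>B. \<bar>f b\<bar> \<le> M b"
      by auto
    have "(\<Sum>b\<in>insert a B. (f(a := t)) b *\<^sub>R b) = x"
    proof -
      have "(\<Sum>b\<in>B. (f(a := t)) b *\<^sub>R b) = (\<Sum>b\<in>B. f b *\<^sub>R b)"
        using insert.hyps by (intro sum.cong) auto
      then show ?thesis using insert.hyps f(1) by simp
    qed
    moreover have "\<forall>b\<in>insert a B. \<bar>(f(a := t)) b\<bar> \<le> M b" using f by auto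
    ultimately show "x \<in> {\<Sum>b\<in>insert a B. f b *\<^sub>R b | f. \<forall>b\<in>insert a B. \<bar>f b\<bar> \<le> M b}"
      by blast
  qed
  moreover have "compact (?p ` ({- M a..M a} \<times> ?K))"
    unfolding split_beta
    by (intro compact_continuous_image compact_Times insert.IH compact_Icc continuous_intros)
  ultimately show ?case by simp
qed

lemma finite_ex_max_image:
  fixes f :: "'a \<Rightarrow> real"
  assumes "finite A" "a \<in> A"
  shows "\<exists>b\<in>A. \<forall>x\<in>A. f x \<le> f b"
proof -
  have "Max (f ` A) \<in> f ` A" using assms by (intro Max_in) auto
  then obtain b where "b \<in> A" "f b = Max (f ` A)" by auto
  then show ?thesis using assms(1) by (intro bexI[of _ b]) simp_all
qed

context iwahori_weyl_structure
begin

interpretation A: group_action W UNIV act by (rule action)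
interpretation W: group W using A.group_hom by (rule group_hom.axioms(1))
interpretation N: normal Waff W by (rule Waff_normal)

abbreviation S :: "'w set" where "S \<equiv> simple_affine_reflections act Waff R C"

abbreviation mul :: "'w \<Rightarrow> 'w \<Rightarrow> 'w" (infixl "\<cdot>" 70) where "g \<cdot> h \<equiv> g \<otimes>\<^bsub>W\<^esub> h"

subsection \<open>The affine Weyl group as a reflection group\<close>

lemma act_mult: "g \<in> carrier W \<Longrightarrow> h \<in> carrier W \<Longrightarrow> act (g \<cdot> h) x = act g (act h x)"
  by (rule A.composition_rule) simp_all

lemma act_one: "act \<one>\<^bsub>W\<^esub> x = x"
  using A.id_eq_one by (metis UNIV_I restrict_apply')

lemma act_inv: "g \<in> carrier W \<Longrightarrow> act (inv\<^bsub>W\<^esub> g) (act g x) = x"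
  "g \<in> carrier W \<Longrightarrow> act g (act (inv\<^bsub>W\<^esub> g) x) = x"
  using act_mult[of "inv\<^bsub>W\<^esub> g" g x] act_mult[of g "inv\<^bsub>W\<^esub> g" x] by (simp_all add: act_one)

lemma S_Waff: "s \<in> S \<Longrightarrow> s \<in> Waff"
  by (simp add: simple_affine_reflections_def)

lemma Waff_carrier: "u \<in> Waff \<Longrightarrow> u \<in> carrier W"
  by (rule N.mem_carrier)

lemma S_carrier: "s \<in> S \<Longrightarrow> s \<in> carrier W"
  by (intro Waff_carrier S_Waff)

text \<open>The action may have a kernel on \<open>W\<close> but not on \<open>Waff\<close>, so
  identities inside \<open>Waff\<close> can be checked on the apartment.\<close>

lemma Waff_faithful:
  assumes "u \<in> Waff" "v \<in> Waff" "\<And>x. act u x = act v x"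
  shows "u = v"
  using Waff_iso assms by (metis bij_betw_imp_inj_on ext inj_onD)

lemma root_nonzero: "\<alpha> \<in> R \<Longrightarrow> \<alpha> \<noteq> 0"
  using root_system by (auto simp: reduced_root_system_def)

lemma finite_roots: "finite R"
  using root_system by (simp add: reduced_root_system_def)

lemma root_reflection: "\<alpha> \<in> R \<Longrightarrow> \<beta> \<in> R \<Longrightarrow> reflection \<alpha> 0 \<beta> \<in> R"
  using root_system by (auto simp: reduced_root_system_def affine_reflection_eq)

lemma root_minus:
  assumes "\<alpha> \<in> R"
  shows "- \<alpha> \<in> R"
  using root_reflection[OF assms assms] root_nonzero[OF assms] by (simp add: reflection_def scaleR_2)

lemma root_integral: "\<alpha> \<in> R \<Longrightarrow> \<beta> \<in> R \<Longrightarrow> 2 * (\<alpha> \<bullet> \<beta>) / (\<alpha> \<bullet> \<alpha>) \<in> \<int>"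
  using root_system by (auto simp: reduced_root_system_def)

lemma ex_root_reflection:
  assumes "\<alpha> \<in> R"
  obtains r where "r \<in> Waff" "act r = reflection \<alpha> (of_int k)"
proof -
  have "affine_reflection \<alpha> k \<in> affine_weyl_transformations R"
    unfolding affine_weyl_transformations_def using assms by (intro generate.incl) blast
  then show thesis
    using Waff_iso that unfolding affine_reflection_eq[symmetric] by (metis bij_betw_imp_surj_on imageE)
qed

section \<open>Signs of affine roots on the base alcove\<close>

lemma alcove_nonempty: "C \<noteq> {}"
  using base_alcove unfolding alcoves_def by (rule in_components_nonempty)

text \<open>\<open>C\<close> is connected and misses every root hyperplane, so the image of
  \<open>C\<close> under an affine root is an interval without 0.\<close>

lemma alcove_sign:
  assumes "\<beta> \<in> R"
  shows "(\<forall>x\<in>C. \<beta> \<bullet> x + of_int l > 0) \<or> (\<forall>x\<in>C. \<beta> \<bullet> x + of_int l < 0)"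
proof -
  let ?h = "\<lambda>x. \<beta> \<bullet> x + of_int l"
  have nz: "?h x \<noteq> 0" if "x \<in> C" for x
    using in_components_subset[OF base_alcove[unfolded alcoves_def]] that assms
    by (auto simp: root_hyperplanes_def affine_hyperplane_def)
  have "connected (?h ` C)"
    using in_components_connected[OF base_alcove[unfolded alcoves_def]]
    by (intro connected_continuous_image continuous_intros)
  then have "is_interval (?h ` C)" by (simp add: is_interval_connected_1)
  then have "\<not> (?h x < 0 \<and> ?h y > 0)" if "x \<in> C" "y \<in> C" for x y
    using that nz mem_is_interval_1_I[of "?h ` C" "?h x" "?h y" 0] by fastforce
  then show ?thesis using nz by (meson linorder_neqE_linordered_idom)
qed

text \<open>For the converse, the half-open segment from \<open>c\<close> to \<open>x\<close> meets
  no root hyperplane. Being connected, it lies in the component \<open>C\<close>, and its end point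
  \<open>x\<close> is then a limit of points of \<open>C\<close>.\<close>

lemma in_closure_alcove_iff:
  assumes c: "c \<in> C"
  shows "x \<in> closure C \<longleftrightarrow> (\<forall>\<beta>\<in>R. \<forall>l. \<beta> \<bullet> c + of_int l > 0 \<longrightarrow> \<beta> \<bullet> x + of_int l \<ge> 0)"
proof
  assume x: "x \<in> closure C"
  show "\<forall>\<beta>\<in>R. \<forall>l. \<beta> \<bullet> c + of_int l > 0 \<longrightarrow> \<beta> \<bullet> x + of_int l \<ge> 0"
  proof (intro ballI allI impI)
    fix \<beta> l assume b: "\<beta> \<in> R" "\<beta> \<bullet> c + of_int l > 0"
    then have "C \<subseteq> {x. \<beta> \<bullet> x + of_int l \<ge> 0}"
      using alcove_sign[OF b(1), of l] c by (fastforce intro: less_imp_le)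
    moreover have "closed {x. \<beta> \<bullet> x + real_of_int l \<ge> 0}"
      by (intro closed_Collect_le continuous_intros)
    ultimately show "\<beta> \<bullet> x + of_int l \<ge> 0"
      using closure_minimal x by blast
  qed
next
  assume x: "\<forall>\<beta>\<in>R. \<forall>l. \<beta> \<bullet> c + of_int l > 0 \<longrightarrow> \<beta> \<bullet> x + of_int l \<ge> 0"
  define p where "p t = c + t *\<^sub>R (x - c)" for t :: real
  have hp: "\<beta> \<bullet> p t + l = (1 - t) * (\<beta> \<bullet> c + l) + t * (\<beta> \<bullet> x + l)" for \<beta> l t
    by (simp add: p_def inner_add_right inner_diff_right algebra_simps)
  have pos: "\<beta> \<bullet> p t + of_int l > 0" if "\<beta> \<in> R" "\<beta> \<bullet> c + of_int l > 0" "0 \<le> t" "t < 1" for \<beta> l t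
  proof -
    have "(1 - t) * (\<beta> \<bullet> c + of_int l) > 0" using that by simp
    moreover have "t * (\<beta> \<bullet> x + of_int l) \<ge> 0" using that x by simp
    ultimately show ?thesis unfolding hp by simp
  qed
  have "\<beta> \<bullet> p t + of_int l \<noteq> 0" if b: "\<beta> \<in> R" and t: "0 \<le> t" "t < 1" for \<beta> l t
  proof (cases "\<beta> \<bullet> c + of_int l > 0")
    case True
    then show ?thesis using pos[OF b True t] by simp
  next
    case False
    then have "(- \<beta>) \<bullet> c + of_int (- l) > 0" using alcove_sign[OF b, of l] c by fastforce
    from pos[OF root_minus[OF b] this t] show ?thesis by simp
  qed
  then have "p ` {0..<1} \<subseteq> - \<Union>(root_hyperplanes R)"
    by (fastforce simp: root_hyperplanes_def affine_hyperplane_def)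
  moreover have "connected (p ` {0..<1})"
    unfolding p_def by (intro connected_continuous_image continuous_intros) simp
  moreover have "c \<in> C \<inter> p ` {0..<1}"
    using c by (auto simp: p_def intro!: rev_image_eqI[of 0])
  ultimately have "p ` {0..<1} \<subseteq> C"
    using base_alcove unfolding alcoves_def by (metis components_maximal empty_iff)
  moreover have "p ` closure {0..<1} \<subseteq> closure (p ` {0..<1})"
    by (intro image_closure_subset closure_subset) (auto simp: p_def intro!: continuous_intros)
  ultimately have "p 1 \<in> closure C"
    using closure_mono[of "p ` {0..<1}" C] by fastforce
  then show "x \<in> closure C" by (simp add: p_def)
qed

lemma closure_alcove_nonneg:
  assumes "\<beta> \<in> R" "\<forall>x\<in>C. \<beta> \<bullet> x + of_int l > 0" "x \<in> closure C"
  shows "\<beta> \<bullet> x + of_int l \<ge> 0"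
  using assms in_closure_alcove_iff alcove_nonempty by blast

text \<open>Of the two forms \<alpha> + k and -\<alpha> - k that define the wall of
  \<open>s\<close>, the one positive on \<open>C\<close> is taken, so that its sign tells the side
  of the wall.\<close>

definition wall_form :: "'w \<Rightarrow> 'v \<Rightarrow> int \<Rightarrow> bool" where
  "wall_form s \<alpha> k \<longleftrightarrow> \<alpha> \<in> R \<and> affine_hyperplane \<alpha> k \<in> walls R C \<and>
     act s = reflection \<alpha> (of_int k) \<and> (\<forall>x\<in>C. \<alpha> \<bullet> x + of_int k > 0)"

lemma ex_wall_form:
  assumes "s \<in> S"
  obtains \<alpha> k where "wall_form s \<alpha> k"
proof -
  obtain \<alpha> k where a: "\<alpha> \<in> R" "affine_hyperplane \<alpha> k \<in> walls R C" "act s = affine_reflection \<alpha> k"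
    using assms unfolding simple_affine_reflections_def by blast
  have "affine_hyperplane (- \<alpha>) (- k) = affine_hyperplane \<alpha> k"
    by (auto simp: affine_hyperplane_def)
  moreover have "affine_reflection (- \<alpha>) (- k) = affine_reflection \<alpha> k"
    using reflection_scale[of "-1" \<alpha> "of_int k"] by (simp add: affine_reflection_eq)
  moreover have "\<forall>x\<in>C. (- \<alpha>) \<bullet> x + of_int (- k) > 0" if "\<forall>x\<in>C. \<alpha> \<bullet> x + of_int k < 0"
    using that by fastforce
  ultimately show thesis
    using that[of \<alpha> k] that[of "- \<alpha>" "- k"] alcove_sign[OF a(1), of k] a root_minus[OF a(1)]
    unfolding wall_form_def affine_reflection_eq[symmetric] by metis
qed

lemma wall_formD:
  assumes "wall_form s \<alpha> k"
  shows "\<alpha> \<in> R" "\<alpha> \<noteq> 0" "act s x = reflection \<alpha> (of_int k) x" "x \<in> C \<Longrightarrow> \<alpha> \<bullet> x + of_int k > 0"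
    "x \<in> closure C \<Longrightarrow> \<alpha> \<bullet> x + of_int k \<ge> 0"
    "\<alpha> \<bullet> act s x + of_int k = - (\<alpha> \<bullet> x + of_int k)"
  using assms root_nonzero closure_alcove_nonneg[of \<alpha> k x] unfolding wall_form_def
  by (auto simp: inner_reflection)

section \<open>Simple reflections and words\<close>

lemma S_square:
  assumes "s \<in> S"
  shows "s \<cdot> s = \<one>\<^bsub>W\<^esub>"
proof -
  obtain \<alpha> k where "wall_form s \<alpha> k" using ex_wall_form[OF assms] by metis
  then have "act (s \<cdot> s) x = act \<one>\<^bsub>W\<^esub> x" for x
    using assms by (simp add: act_mult S_carrier act_one wall_formD reflection_involutive)
  then show ?thesis using assms by (intro Waff_faithful) (simp_all add: S_Waff)
qed

lemma S_inv: "s \<in> S \<Longrightarrow> inv\<^bsub>W\<^esub> s = s"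
  using S_square S_carrier by (metis W.inv_equality)

lemma S_cancel: "s \<in> S \<Longrightarrow> g \<in> carrier W \<Longrightarrow> s \<cdot> (s \<cdot> g) = g"
  by (metis S_carrier S_square W.l_one W.m_assoc)

lemma word_Cons: "word W (s # ss) = s \<cdot> word W ss"
  by (simp add: word_def)

lemma word_Nil: "word W [] = \<one>\<^bsub>W\<^esub>"
  by (simp add: word_def)

lemma word_Waff: "set ss \<subseteq> S \<Longrightarrow> word W ss \<in> Waff"
  by (induction ss) (auto simp: word_Nil word_Cons S_Waff)

lemma word_append:
  "set ss \<subseteq> S \<Longrightarrow> set ts \<subseteq> S \<Longrightarrow> word W (ss @ ts) = word W ss \<cdot> word W ts"
  by (induction ss) (auto simp: word_Nil word_Cons W.m_assoc S_carrier Waff_carrier word_Waff)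

lemma word_rev: "set ss \<subseteq> S \<Longrightarrow> word W (rev ss) = inv\<^bsub>W\<^esub> (word W ss)"
  by (induction ss)
    (auto simp: word_Nil word_Cons word_append S_carrier S_inv Waff_carrier word_Waff W.inv_mult_group)

lemma Waff_word:
  assumes "u \<in> Waff"
  obtains ss where "set ss \<subseteq> S" "u = word W ss"
proof -
  have "u \<in> generate W S" using assms simple_generate by simp
  then have "\<exists>ss. set ss \<subseteq> S \<and> u = word W ss"
  proof induction
    case one
    show ?case by (intro exI[of _ "[]"]) (simp add: word_Nil)
  next
    case (incl s)
    then show ?case by (intro exI[of _ "[s]"]) (simp add: word_Nil word_Cons S_carrier)
  next
    case (inv s)
    then show ?case by (intro exI[of _ "[s]"]) (simp add: word_Nil word_Cons S_carrier S_inv)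
  next
    case (eng g h)
    then show ?case by (metis word_append set_append Un_least)
  qed
  then show thesis using that by blast
qed

lemma Waff_induct [consumes 1, case_names one mult]:
  assumes "u \<in> Waff" "P \<one>\<^bsub>W\<^esub>" "\<And>s u. s \<in> S \<Longrightarrow> u \<in> Waff \<Longrightarrow> P u \<Longrightarrow> P (s \<cdot> u)"
  shows "P u"
proof -
  have "P (word W ss)" if "set ss \<subseteq> S" for ss
    using that by (induction ss) (auto simp: word_Nil word_Cons assms word_Waff)
  then show ?thesis using assms(1) Waff_word by metis
qed

section \<open>Action by rigid motions, and sides of translated alcoves\<close>

lemma rigid_motion_one: "rigid_motion R (act \<one>\<^bsub>W\<^esub>)"
  using rigid_motion_translation[of R 0] by (simp add: act_one[abs_def])

lemma rigid_motion_mult: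
  assumes "g \<in> carrier W" "h \<in> carrier W" "rigid_motion R (act g)" "rigid_motion R (act h)"
  shows "rigid_motion R (act (g \<cdot> h))"
  using rigid_motion_comp[OF assms(3,4)] by (simp add: act_mult[OF assms(1,2), abs_def])

lemma rigid_motion_Waff: "u \<in> Waff \<Longrightarrow> rigid_motion R (act u)"
proof (induction rule: Waff_induct)
  case (mult s u)
  obtain \<alpha> k where "wall_form s \<alpha> k" using ex_wall_form[OF mult(1)] by metis
  then have "rigid_motion R (act s)"
    unfolding wall_form_def by (simp add: rigid_motion_reflection root_nonzero)
  with mult show ?case by (intro rigid_motion_mult) (simp_all add: S_carrier Waff_carrier)
qed (rule rigid_motion_one)

text \<open>Write \<open>w\<close> as a translation times an element of the finite Weyl group; the
  latter lies in \<open>Waff\<close> and is a product of reflections.\<close>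

lemma rigid_motion_act:
  assumes "w \<in> carrier W"
  shows "rigid_motion R (act w)"
proof -
  obtain t u where w: "t \<in> translation_subgroup W act" "u \<in> Waff" "w = t \<cdot> u"
    using assms decomp_translations unfolding semidirect_def set_mult_def finite_weyl_group_def
    by blast
  obtain v where "act t = (\<lambda>x. x + v)" "t \<in> carrier W"
    using w(1) unfolding translation_subgroup_def by auto
  then show ?thesis using w rigid_motion_translation[of R v]
    by (simp add: rigid_motion_mult rigid_motion_Waff Waff_carrier)
qed

lemma alcove_decomposition:
  assumes "w \<in> carrier W"
  obtains u \<tau> where "u \<in> Waff" "\<tau> \<in> carrier W" "act \<tau> ` C = C" "w = u \<cdot> \<tau>"
  using assms decomp_stabilizer unfolding semidirect_def set_mult_def alcove_stabilizer_def by blast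

text \<open>Affine roots are permuted by \<open>Waff\<close>: pulling back along a simple reflection
  changes the offset by \<open>k * n\<close>, where the Cartan number \<open>n\<close> is an
  integer.\<close>

lemma root_form_pullback:
  assumes "u \<in> Waff" "\<beta> \<in> R"
  shows "\<exists>\<gamma>\<in>R. \<exists>m::int. \<forall>x. \<beta> \<bullet> act u x + of_int l = \<gamma> \<bullet> x + of_int m"
  using assms
proof (induction arbitrary: \<beta> l rule: Waff_induct)
  case one
  then show ?case by (auto simp: act_one)
next
  case (mult s u)
  obtain \<alpha> k where a: "wall_form s \<alpha> k" using ex_wall_form[OF mult(1)] by metis
  note aR = wall_formD(1)[OF a]
  obtain n where n: "2 * (\<alpha> \<bullet> \<beta>) / (\<alpha> \<bullet> \<alpha>) = of_int n"
    using root_integral[OF aR mult.prems] by (auto elim: Ints_cases)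
  have r: "reflection \<alpha> 0 \<beta> = \<beta> - of_int n *\<^sub>R \<alpha>" using n by (simp add: reflection_def)
  have "\<beta> \<bullet> act s y + of_int l = reflection \<alpha> 0 \<beta> \<bullet> y + of_int (l - k * n)" for y
  proof -
    have "\<beta> \<bullet> act s y = \<beta> \<bullet> y - (\<alpha> \<bullet> y + of_int k) * (2 * (\<alpha> \<bullet> \<beta>) / (\<alpha> \<bullet> \<alpha>))"
      by (simp add: wall_formD(3)[OF a] reflection_def inner_diff_right inner_commute[of \<beta> \<alpha>])
    then show ?thesis unfolding n r by (simp add: inner_diff_left algebra_simps)
  qed
  moreover obtain \<gamma> m where
    "\<gamma> \<in> R" "\<forall>x. reflection \<alpha> 0 \<beta> \<bullet> act u x + of_int (l - k * n) = \<gamma> \<bullet> x + of_int m"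
    using mult.IH[OF root_reflection[OF aR mult.prems], of "l - k * n"] by blast
  ultimately have "\<forall>x. \<beta> \<bullet> act (s \<cdot> u) x + of_int l = \<gamma> \<bullet> x + of_int m"
    using mult(1,2) by (metis act_mult S_carrier Waff_carrier)
  then show ?case using \<open>\<gamma> \<in> R\<close> by blast
qed

text \<open>In \<open>w = u \<cdot> \<tau>\<close> the factor \<tau> maps \<open>C\<close> to
  itself, and pulling the affine root back along \<open>u\<close> gives an affine root, which has
  constant sign on \<open>C\<close>.\<close>

lemma alcove_side:
  assumes "w \<in> carrier W" "\<beta> \<in> R"
  shows "(\<forall>x\<in>C. \<beta> \<bullet> act w x + of_int l > 0) \<or> (\<forall>x\<in>C. \<beta> \<bullet> act w x + of_int l < 0)"
proof -
  obtain u \<tau> where w: "u \<in> Waff" "\<tau> \<in> carrier W" "act \<tau> ` C = C" "w = u \<cdot> \<tau>"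
    using alcove_decomposition[OF assms(1)] by metis
  obtain \<gamma> m where g: "\<gamma> \<in> R" "\<forall>x. \<beta> \<bullet> act u x + of_int l = \<gamma> \<bullet> x + of_int m"
    using root_form_pullback[OF w(1) assms(2)] by blast
  show ?thesis
    using alcove_sign[OF g(1), of m] g(2) w by (auto simp: act_mult Waff_carrier)
qed

lemma closure_alcove_sign:
  assumes "w \<in> carrier W" "x \<in> closure C"
  shows "(\<forall>x\<in>C. \<beta> \<bullet> act w x + l \<ge> 0) \<Longrightarrow> \<beta> \<bullet> act w x + l \<ge> 0"
    and "(\<forall>x\<in>C. \<beta> \<bullet> act w x + l \<le> 0) \<Longrightarrow> \<beta> \<bullet> act w x + l \<le> 0"
proof -
  have "closed {x. \<beta> \<bullet> act w x + l \<ge> 0}" "closed {x. \<beta> \<bullet> act w x + l \<le> 0}"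
    by (intro closed_Collect_le continuous_intros rigid_motion_continuous[OF rigid_motion_act[OF assms(1)]])+
  then show "(\<forall>x\<in>C. \<beta> \<bullet> act w x + l \<ge> 0) \<Longrightarrow> \<beta> \<bullet> act w x + l \<ge> 0"
    "(\<forall>x\<in>C. \<beta> \<bullet> act w x + l \<le> 0) \<Longrightarrow> \<beta> \<bullet> act w x + l \<le> 0"
    using assms(2) closure_minimal[of C "{x. \<beta> \<bullet> act w x + l \<ge> 0}"]
      closure_minimal[of C "{x. \<beta> \<bullet> act w x + l \<le> 0}"] by blast+
qed

text \<open>The alcoves \<open>g C\<close> and \<open>g s C\<close> share the part of the wall of
  \<open>s\<close> in the closure of \<open>C\<close>, moved by \<open>g\<close>. The form of
  \<open>t\<close> has both signs there, so it vanishes on it. As this part spans the wall affinely,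
  \<open>g\<close> carries the wall of \<open>s\<close> into that of \<open>t\<close> and conjugates
  \<open>s\<close> to \<open>t\<close>.\<close>

lemma adjacent_alcoves:
  assumes g: "g \<in> carrier W" and s: "s \<in> S" and t: "t \<in> S" "wall_form t \<beta> l"
    and pos: "\<forall>x\<in>C. \<beta> \<bullet> act g x + of_int l \<ge> 0"
    and neg: "\<forall>x\<in>C. \<beta> \<bullet> act g (act s x) + of_int l \<le> 0"
  shows "g \<cdot> s = t \<cdot> g"
proof -
  obtain \<alpha> k where a: "wall_form s \<alpha> k" using ex_wall_form[OF s] by metis
  let ?H = "affine_hyperplane \<alpha> k"
  have "?H \<inter> closure C \<subseteq> {x. \<beta> \<bullet> act g x + of_int l = 0}"
  proof (clarsimp simp: affine_hyperplane_def)
    fix x assume x: "\<alpha> \<bullet> x + of_int k = 0" "x \<in> closure C"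
    have "act s x = x" using x(1) by (simp add: wall_formD(3)[OF a] reflection_fixes)
    moreover have "\<beta> \<bullet> act g (act s x) + of_int l \<le> 0"
      using closure_alcove_sign(2)[of "g \<cdot> s" x \<beta> "of_int l"] neg g s x(2)
      by (simp add: act_mult S_carrier)
    moreover have "\<beta> \<bullet> act g x + of_int l \<ge> 0"
      using closure_alcove_sign(1)[OF g x(2), of \<beta> "of_int l"] pos by simp
    ultimately show "\<beta> \<bullet> act g x + of_int l = 0" by simp
  qed
  moreover have "affine {x. \<beta> \<bullet> act g x + of_int l = 0}"
  proof -
    obtain L a where L: "linear L" "\<And>x. act g x = L x + a"
      using rigid_motionE[OF rigid_motion_act[OF g]] by metis
    have "\<beta> \<bullet> act g (p *\<^sub>R x + q *\<^sub>R y) + of_int l =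
        p * (\<beta> \<bullet> act g x + of_int l) + q * (\<beta> \<bullet> act g y + of_int l)" if "p + q = 1" for p q x y
    proof -
      have "(p + q) * (\<beta> \<bullet> a + of_int l) = \<beta> \<bullet> a + of_int l" using that by simp
      then show ?thesis
        by (simp add: L(2) linear_add[OF L(1)] linear_scale[OF L(1)] inner_add_right algebra_simps)
    qed
    then show ?thesis unfolding affine_def by simp
  qed
  moreover have "affine hull (?H \<inter> closure C) = ?H"
    using a unfolding wall_form_def walls_def by blast
  ultimately have H: "\<beta> \<bullet> act g x + of_int l = 0" if "\<alpha> \<bullet> x + of_int k = 0" for x
    using hull_minimal[of "?H \<inter> closure C" "{x. \<beta> \<bullet> act g x + of_int l = 0}" affine] that
    by (auto simp: affine_hyperplane_def)
  obtain \<gamma> m where c: "\<gamma> \<noteq> 0" "\<And>x. \<gamma> \<bullet> act g x + m = \<alpha> \<bullet> x + of_int k"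
    "\<And>x. act g (reflection \<alpha> (of_int k) x) = reflection \<gamma> m (act g x)"
    using rigid_motion_reflection_conj[OF rigid_motion_act[OF g] wall_formD(2)[OF a], where k = "of_int k"]
    by metis
  have "reflection \<gamma> m = reflection \<beta> (of_int l)"
  proof (rule reflection_eqI[OF c(1) wall_formD(2)[OF t(2)]])
    fix x assume "\<gamma> \<bullet> x + m = 0"
    then show "\<beta> \<bullet> x + of_int l = 0"
      using H[of "act (inv\<^bsub>W\<^esub> g) x"] c(2)[of "act (inv\<^bsub>W\<^esub> g) x"] g by (simp add: act_inv)
  qed
  then have "act g (act s x) = act t (act g x)" for x
    using c(3) by (simp add: wall_formD(3)[OF a] wall_formD(3)[OF t(2)])
  then have "act (g \<cdot> s \<cdot> inv\<^bsub>W\<^esub> g) x = act t x" for x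
    using g s by (simp add: act_mult act_inv S_carrier)
  \<comment> \<open>Normality is essential here: only inside \<open>Waff\<close> does equality of
    actions give equality of elements.\<close>
  moreover have "g \<cdot> s \<cdot> inv\<^bsub>W\<^esub> g \<in> Waff" using g s by (intro N.inv_op_closed2 S_Waff)
  ultimately have "g \<cdot> s \<cdot> inv\<^bsub>W\<^esub> g = t" using t by (intro Waff_faithful) (simp_all add: S_Waff)
  then show ?thesis using g s by (metis S_carrier W.inv_closed W.inv_solve_right W.m_closed)
qed

subsection \<open>Length and sides of walls\<close>

abbreviation len :: "'w \<Rightarrow> nat" where "len \<equiv> iw_length W act Waff R C"

lemma word_length_le: "set ss \<subseteq> S \<Longrightarrow> word_length W S (word W ss) \<le> length ss"
  unfolding word_length_def by (rule Least_le) blast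

lemma reduced_word:
  assumes "u \<in> Waff"
  obtains ss where "set ss \<subseteq> S" "u = word W ss" "length ss = word_length W S u"
proof -
  have "\<exists>n ss. length ss = n \<and> set ss \<subseteq> S \<and> u = word W ss"
    using Waff_word[OF assms] by metis
  from LeastI_ex[OF this] show thesis using that unfolding word_length_def by metis
qed

lemma stabilizer_inv:
  assumes "\<tau> \<in> carrier W" "act \<tau> ` C = C"
  shows "act (inv\<^bsub>W\<^esub> \<tau>) ` C = C"
proof -
  have "act (inv\<^bsub>W\<^esub> \<tau>) ` (act \<tau> ` C) = C" using assms(1) by (simp add: image_image act_inv)
  then show ?thesis by (simp only: assms(2))
qed

text \<open>Two decompositions of the same element give
  \<open>inv v \<cdot> u = \<sigma> \<cdot> inv \<tau>\<close>, which lies in \<open>Waff\<close>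
  and in the alcove stabilizer, hence is trivial. So the definite description in
  \<open>iw_length\<close> denotes \<open>u\<close>.\<close>

lemma len_decomposition:
  assumes "u \<in> Waff" "\<tau> \<in> carrier W" "act \<tau> ` C = C"
  shows "len (u \<cdot> \<tau>) = word_length W S u"
proof -
  have sub: "subgroup (alcove_stabilizer W act C) W" "Waff \<inter> alcove_stabilizer W act C = {\<one>\<^bsub>W\<^esub>}"
    using decomp_stabilizer unfolding semidirect_def by blast+
  have t: "\<tau> \<in> alcove_stabilizer W act C" using assms by (simp add: alcove_stabilizer_def)
  have "v = u" if v: "v \<in> Waff" "\<sigma> \<in> alcove_stabilizer W act C" "u \<cdot> \<tau> = v \<cdot> \<sigma>" for v \<sigma>
  proof -
    have c: "v \<in> carrier W" "u \<in> carrier W" "\<sigma> \<in> carrier W"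
      using v assms by (auto simp: Waff_carrier alcove_stabilizer_def)
    have "inv\<^bsub>W\<^esub> v \<cdot> u = \<sigma> \<cdot> inv\<^bsub>W\<^esub> \<tau>"
      using c assms(2) v(3)
      by (metis W.inv_closed W.inv_solve_left W.inv_solve_right W.m_assoc W.m_closed)
    moreover have "inv\<^bsub>W\<^esub> v \<cdot> u \<in> Waff" using v assms by simp
    moreover have "\<sigma> \<cdot> inv\<^bsub>W\<^esub> \<tau> \<in> alcove_stabilizer W act C"
      using sub(1) v(2) t by (simp add: subgroup.m_closed subgroup.m_inv_closed)
    ultimately have "inv\<^bsub>W\<^esub> v \<cdot> u = \<one>\<^bsub>W\<^esub>" using sub(2) by auto
    then show "v = u" using c by (metis W.inv_solve_left W.one_closed W.r_one)
  qed
  then have "(THE v. v \<in> Waff \<and> (\<exists>\<sigma>\<in>alcove_stabilizer W act C. u \<cdot> \<tau> = v \<cdot> \<sigma>)) = u"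
    using assms(1) t by (intro the_equality) blast+
  then show ?thesis unfolding iw_length_def by simp
qed

lemma len_Waff: "u \<in> Waff \<Longrightarrow> len u = word_length W S u"
  using len_decomposition[of u "\<one>\<^bsub>W\<^esub>"] by (simp add: act_one Waff_carrier)

text \<open>The first wall crossing in the gallery of \<open>ss\<close> that leaves the positive side of the wall
  of \<open>s\<close> happens at that wall, so the corresponding letter can be deleted.\<close>

lemma exchange:
  assumes s: "s \<in> S" "wall_form s \<alpha> k"
    and ss: "set ss \<subseteq> S" "\<forall>x\<in>C. \<alpha> \<bullet> act (word W ss) x + of_int k < 0"
  shows "\<exists>ts. set ts \<subseteq> S \<and> length ts < length ss \<and> s \<cdot> word W ss = word W ts"
  using ss
proof (induction ss rule: rev_induct)
  case Nil
  then show ?case using alcove_nonempty wall_formD(4)[OF s(2)]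
    by (fastforce simp: word_Nil act_one)
next
  case (snoc t ss)
  let ?g = "word W ss"
  have t: "t \<in> S" "set ss \<subseteq> S" using snoc.prems by auto
  have g: "?g \<in> carrier W" using t by (simp add: word_Waff Waff_carrier)
  have w: "word W (ss @ [t]) = ?g \<cdot> t"
    using t by (simp add: word_append word_Cons word_Nil S_carrier)
  show ?case
  proof (cases "\<forall>x\<in>C. \<alpha> \<bullet> act ?g x + of_int k < 0")
    case True
    then obtain ts where ts: "set ts \<subseteq> S" "length ts < length ss" "s \<cdot> ?g = word W ts"
      using snoc.IH t by blast
    have "s \<cdot> word W (ss @ [t]) = word W (ts @ [t])"
      using t ts g s by (simp add: w word_append word_Cons word_Nil S_carrier W.m_assoc[symmetric])
    then show ?thesis using ts t by (intro exI[of _ "ts @ [t]"]) simp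
  next
    case False
    then have "\<forall>x\<in>C. \<alpha> \<bullet> act ?g x + of_int k \<ge> 0"
      using alcove_side[OF g wall_formD(1)[OF s(2)], of k] by (auto intro: less_imp_le)
    moreover have "\<forall>x\<in>C. \<alpha> \<bullet> act ?g (act t x) + of_int k \<le> 0"
      using snoc.prems(2) t g unfolding w by (simp add: act_mult S_carrier less_imp_le)
    ultimately have "?g \<cdot> t = s \<cdot> ?g" using adjacent_alcoves[OF g t(1) s] by blast
    then have "s \<cdot> word W (ss @ [t]) = ?g" using g s by (simp add: w S_cancel)
    then show ?thesis using t by (intro exI[of _ ss]) simp
  qed
qed

text \<open>As \<tau> preserves \<open>C\<close>, the alcoves of \<open>w\<close> and of its factor
  \<open>u\<close> in \<open>Waff\<close> coincide; \<open>exchange\<close> then deletes a letter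
  from a reduced word of \<open>u\<close>.\<close>

lemma len_less_if_neg:
  assumes s: "s \<in> S" "wall_form s \<alpha> k" and w: "w \<in> carrier W"
    and neg: "\<forall>x\<in>C. \<alpha> \<bullet> act w x + of_int k < 0"
  shows "len (s \<cdot> w) < len w"
proof -
  obtain u \<tau> where d: "u \<in> Waff" "\<tau> \<in> carrier W" "act \<tau> ` C = C" "w = u \<cdot> \<tau>"
    using alcove_decomposition[OF w] by metis
  have sw: "s \<cdot> w = (s \<cdot> u) \<cdot> \<tau>" using d s by (simp add: W.m_assoc S_carrier Waff_carrier)
  obtain ss where ss: "set ss \<subseteq> S" "u = word W ss" "length ss = word_length W S u"
    using reduced_word[OF d(1)] by metis
  have "\<forall>x\<in>act \<tau> ` C. \<alpha> \<bullet> act u x + of_int k < 0"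
    unfolding ball_simps using neg d(1,2,4) by (simp add: act_mult Waff_carrier)
  then obtain ts where "set ts \<subseteq> S" "length ts < length ss" "s \<cdot> u = word W ts"
    using exchange[OF s ss(1)] ss(2) unfolding d(3) by auto
  then have "word_length W S (s \<cdot> u) < word_length W S u"
    using word_length_le[of ts] ss(3) by simp
  then show ?thesis unfolding sw using d s by (simp add: len_decomposition S_Waff)
qed

text \<open>The wall separates the alcoves of \<open>w\<close> and \<open>s \<cdot> w\<close>, so
  the previous lemma applies to \<open>s \<cdot> w\<close>. Together the two lemmas translate
  between lengths and sides of walls.\<close>

lemma len_greater_if_pos:
  assumes s: "s \<in> S" "wall_form s \<alpha> k" and w: "w \<in> carrier W"
    and pos: "\<forall>x\<in>C. \<alpha> \<bullet> act w x + of_int k > 0"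
  shows "len w < len (s \<cdot> w)"
proof -
  have "\<forall>x\<in>C. \<alpha> \<bullet> act (s \<cdot> w) x + of_int k < 0"
    using pos w s by (simp only: act_mult S_carrier wall_formD(6)[OF s(2)] neg_less_0_iff_less)
  then have "len (s \<cdot> (s \<cdot> w)) < len (s \<cdot> w)"
    using w s by (intro len_less_if_neg[OF s]) (simp_all add: S_carrier)
  then show ?thesis using s w by (simp add: S_cancel)
qed

lemma neg_if_len_le:
  assumes s: "s \<in> S" "wall_form s \<alpha> k" and w: "w \<in> carrier W" and "len (s \<cdot> w) \<le> len w"
  shows "\<forall>x\<in>C. \<alpha> \<bullet> act w x + of_int k < 0"
  using len_greater_if_pos[OF s w] alcove_side[OF w wall_formD(1)[OF s(2)], of k] assms(4) by force

lemma len_mult_neq: "s \<in> S \<Longrightarrow> w \<in> carrier W \<Longrightarrow> len (s \<cdot> w) \<noteq> len w"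
  by (metis ex_wall_form len_less_if_neg neg_if_len_le order_refl less_irrefl)

lemma len_mult_le:
  assumes s: "s \<in> S" and w: "w \<in> carrier W"
  shows "len (s \<cdot> w) \<le> Suc (len w)"
proof -
  obtain u \<tau> where d: "u \<in> Waff" "\<tau> \<in> carrier W" "act \<tau> ` C = C" "w = u \<cdot> \<tau>"
    using alcove_decomposition[OF w] by metis
  have sw: "s \<cdot> w = (s \<cdot> u) \<cdot> \<tau>" using d s by (simp add: W.m_assoc S_carrier Waff_carrier)
  obtain ss where "set ss \<subseteq> S" "u = word W ss" "length ss = word_length W S u"
    using reduced_word[OF d(1)] by metis
  then show ?thesis unfolding sw using d s word_length_le[of "s # ss"]
    by (simp add: len_decomposition S_Waff word_Cons)
qed

section \<open>The alcove stabilizer and inverses\<close>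

lemma first_letter:
  assumes u: "u \<in> Waff" "u \<noteq> \<one>\<^bsub>W\<^esub>"
  obtains s where "s \<in> S" "len (s \<cdot> u) < len u"
proof -
  obtain ss where ss: "set ss \<subseteq> S" "u = word W ss" "length ss = word_length W S u"
    using reduced_word[OF u(1)] by metis
  with u obtain s ts where st: "ss = s # ts" by (cases ss) (auto simp: word_Nil)
  have "s \<cdot> u = word W ts"
    using ss st by (simp add: word_Cons S_cancel word_Waff Waff_carrier)
  then have "len (s \<cdot> u) < len u"
    using ss st u word_length_le[of ts] by (simp add: len_Waff word_Waff)
  then show thesis using that[of s] ss(1) st by simp
qed

text \<open>The conjugate \<open>r\<close> of \<open>s\<close> is a nontrivial element of
  \<open>Waff\<close>, so some \<open>t\<close> shortens it and has \<open>r C\<close> on the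
  negative side of its wall. But \<open>r C\<close> is the image of \<open>s C\<close> under \<tau>,
  while \<tau> leaves \<open>C\<close> on the positive side; adjacency identifies \<open>r\<close>
  with \<open>t\<close>.\<close>

lemma stabilizer_permutes_S:
  assumes \<tau>: "\<tau> \<in> carrier W" "act \<tau> ` C = C" and s: "s \<in> S"
  obtains t where "t \<in> S" "\<tau> \<cdot> s = t \<cdot> \<tau>"
proof -
  let ?r = "\<tau> \<cdot> s \<cdot> inv\<^bsub>W\<^esub> \<tau>"
  have r: "?r \<in> Waff" using \<tau> s by (intro N.inv_op_closed2 S_Waff)
  have r': "?r \<cdot> \<tau> = \<tau> \<cdot> s" using \<tau> s by (simp add: W.m_assoc S_carrier)
  \<comment> \<open>Otherwise \<open>s\<close> would act trivially, although it negates a form that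
    is positive on \<open>C\<close>.\<close>
  have "?r \<noteq> \<one>\<^bsub>W\<^esub>"
  proof
    assume "?r = \<one>\<^bsub>W\<^esub>"
    then have "\<tau> = \<tau> \<cdot> s" using r' \<tau> by simp
    then have "s = \<one>\<^bsub>W\<^esub>" using \<tau> s by (metis S_carrier W.l_cancel_one)
    moreover obtain \<alpha> k where a: "wall_form s \<alpha> k" using ex_wall_form[OF s] by metis
    moreover obtain x where "x \<in> C" using alcove_nonempty by blast
    ultimately show False using wall_formD(4)[OF a, of x] wall_formD(6)[OF a, of x] by (simp add: act_one)
  qed
  then obtain t where t: "t \<in> S" "len (t \<cdot> ?r) < len ?r" using first_letter[OF r] by metis
  obtain \<beta> l where b: "wall_form t \<beta> l" using ex_wall_form[OF t(1)] by metis
  have neg: "\<forall>x\<in>C. \<beta> \<bullet> act ?r x + of_int l < 0"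
    using t(2) by (intro neg_if_len_le[OF t(1) b Waff_carrier[OF r]]) simp
  have "act \<tau> (act s x) = act ?r (act \<tau> x)" for x
    using act_mult[of ?r \<tau> x] act_mult[of \<tau> s x] r' \<tau> s r by (simp add: S_carrier Waff_carrier)
  then have "\<forall>x\<in>C. \<beta> \<bullet> act \<tau> (act s x) + of_int l \<le> 0"
    using neg \<tau>(2) by (metis imageI less_imp_le)
  moreover have "\<forall>x\<in>C. \<beta> \<bullet> act \<tau> x + of_int l \<ge> 0"
    using wall_formD(4)[OF b] \<tau>(2) by (metis imageI less_imp_le)
  ultimately have "\<tau> \<cdot> s = t \<cdot> \<tau>" using adjacent_alcoves[OF \<tau>(1) s t(1) b] by blast
  then show thesis using that t by blast
qed

lemma stabilizer_permutes_words:
  assumes \<tau>: "\<tau> \<in> carrier W" "act \<tau> ` C = C" and "set ss \<subseteq> S"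
  shows "\<exists>ts. set ts \<subseteq> S \<and> length ts = length ss \<and> \<tau> \<cdot> word W ss = word W ts \<cdot> \<tau>"
  using assms(3)
proof (induction ss)
  case Nil
  then show ?case using \<tau> by (simp add: word_Nil)
next
  case (Cons s ss)
  then obtain ts where ts: "set ts \<subseteq> S" "length ts = length ss" "\<tau> \<cdot> word W ss = word W ts \<cdot> \<tau>"
    by auto
  obtain t where t: "t \<in> S" "\<tau> \<cdot> s = t \<cdot> \<tau>"
    using stabilizer_permutes_S[OF \<tau>] Cons.prems by (metis list.set_intros(1) subsetD)
  have c: "word W ss \<in> carrier W" "word W ts \<in> carrier W" "s \<in> carrier W" "t \<in> carrier W"
    using Cons.prems ts t by (simp_all add: word_Waff Waff_carrier S_carrier)
  have "\<tau> \<cdot> word W (s # ss) = t \<cdot> \<tau> \<cdot> word W ss"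
    using c \<tau> t by (simp add: word_Cons W.m_assoc[symmetric])
  also have "\<dots> = word W (t # ts) \<cdot> \<tau>"
    using c \<tau> ts by (simp add: word_Cons W.m_assoc)
  finally show ?case using ts t by (intro exI[of _ "t # ts"]) simp
qed

text \<open>The inverse of \<open>u \<cdot> \<tau>\<close> is the inverse of \<tau> followed by the
  reversed word of \<open>u\<close>; moving the stabilizer element to the right replaces letters
  without changing their number.\<close>

lemma len_inv_le:
  assumes w: "w \<in> carrier W"
  shows "len (inv\<^bsub>W\<^esub> w) \<le> len w"
proof -
  obtain u \<tau> where d: "u \<in> Waff" "\<tau> \<in> carrier W" "act \<tau> ` C = C" "w = u \<cdot> \<tau>"
    using alcove_decomposition[OF w] by metis
  obtain ss where ss: "set ss \<subseteq> S" "u = word W ss" "length ss = word_length W S u"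
    using reduced_word[OF d(1)] by metis
  obtain ts where ts: "set ts \<subseteq> S" "length ts = length ss"
    "inv\<^bsub>W\<^esub> \<tau> \<cdot> word W (rev ss) = word W ts \<cdot> inv\<^bsub>W\<^esub> \<tau>"
    using stabilizer_permutes_words[of "inv\<^bsub>W\<^esub> \<tau>" "rev ss"] d ss(1)
    by (auto simp: stabilizer_inv)
  have "inv\<^bsub>W\<^esub> w = word W ts \<cdot> inv\<^bsub>W\<^esub> \<tau>"
    using ts(3) d ss by (simp add: word_rev W.inv_mult_group Waff_carrier word_Waff)
  then show ?thesis using word_length_le[OF ts(1)] ts d ss
    by (simp add: len_decomposition stabilizer_inv word_Waff)
qed

lemma len_inv: "w \<in> carrier W \<Longrightarrow> len (inv\<^bsub>W\<^esub> w) = len w"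
  using len_inv_le[of w] len_inv_le[of "inv\<^bsub>W\<^esub> w"] by simp

lemma len_mult_right:
  assumes "s \<in> S" "w \<in> carrier W"
  shows "len (w \<cdot> s) = len (s \<cdot> inv\<^bsub>W\<^esub> w)"
  using len_inv[of "w \<cdot> s"] assms by (simp add: S_carrier W.inv_mult_group S_inv)

lemma len_mult_right_le: "s \<in> S \<Longrightarrow> w \<in> carrier W \<Longrightarrow> len (w \<cdot> s) \<le> Suc (len w)"
  using len_mult_le[of s "inv\<^bsub>W\<^esub> w"] by (simp add: len_mult_right len_inv)

lemma len_mult_right_neq: "s \<in> S \<Longrightarrow> w \<in> carrier W \<Longrightarrow> len (w \<cdot> s) \<noteq> len w"
  using len_mult_neq[of s "inv\<^bsub>W\<^esub> w"] by (simp add: len_mult_right len_inv)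

subsection \<open>The closed alcove\<close>

text \<open>For \<open>c\<close> in \<open>C\<close> this set is empty exactly when \<open>x\<close>
  lies in the closed alcove; its cardinality serves as a termination measure.\<close>

definition separating :: "'v \<Rightarrow> 'v \<Rightarrow> ('v \<times> int) set" where
  "separating c x = {(\<beta>, l). \<beta> \<in> R \<and> \<beta> \<bullet> c + of_int l > 0 \<and> \<beta> \<bullet> x + of_int l < 0}"

lemma finite_separating: "finite (separating c x)"
proof -
  have "separating c x \<subseteq> (SIGMA \<beta>:R. {\<lfloor>- (\<beta> \<bullet> c)\<rfloor>..\<lceil>- (\<beta> \<bullet> x)\<rceil>})"
    unfolding separating_def by (auto; linarith)
  then show ?thesis by (rule finite_subset) (simp add: finite_roots)
qed

text \<open>A broken line from \<open>c\<close> to the mirror image of \<open>x\<close> is obtained by reflecting the end of the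
  segment from \<open>c\<close> to \<open>x\<close> at its intersection \<open>z\<close> with the mirror; it crosses no more
  hyperplanes than the segment, and not the mirror.\<close>

lemma separating_reflection:
  assumes "(\<alpha>, k) \<in> separating c x"
  shows "card (separating c (reflection \<alpha> (of_int k) x)) < card (separating c x)"
proof -
  define s where "s = reflection \<alpha> (of_int k)"
  define h where "h p y = fst p \<bullet> y + of_int (snd p)" for p :: "'v \<times> int" and y
  have sep: "p \<in> separating c y \<longleftrightarrow> fst p \<in> R \<and> h p c > 0 \<and> h p y < 0" for p y
    unfolding separating_def h_def by (auto simp: split_beta)
  have a: "\<alpha> \<in> R" "h (\<alpha>, k) c > 0" "h (\<alpha>, k) x < 0" using assms by (auto simp: sep)
  obtain r where r: "r \<in> Waff" "act r = s" using ex_root_reflection[OF a(1)] unfolding s_def by metis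
  have "\<forall>p. \<exists>q. fst p \<in> R \<longrightarrow> fst q \<in> R \<and> (\<forall>y. h p (s y) = h q y)"
    using root_form_pullback[OF r(1)] unfolding r(2) h_def by (metis fst_conv snd_conv)
  then obtain f where f: "fst p \<in> R \<Longrightarrow> fst (f p) \<in> R"
    and hf: "fst p \<in> R \<Longrightarrow> h (f p) y = h p (s y)" for p y
    by metis
  define t where "t = h (\<alpha>, k) c / (h (\<alpha>, k) c - h (\<alpha>, k) x)"
  define z where "z = c + t *\<^sub>R (x - c)"
  have t: "0 < t" "t < 1" using a by (simp_all add: t_def)
  have hz: "h p z = (1 - t) * h p c + t * h p x" for p
    by (simp add: h_def z_def inner_add_right inner_diff_right algebra_simps)
  have z: "h (\<alpha>, k) z = 0" using a by (simp add: hz t_def field_simps)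
  have sz: "s z = z" and ss: "s (s y) = y" for y
    using z root_nonzero[OF a(1)] unfolding s_def h_def
    by (simp_all add: reflection_fixes reflection_involutive)
  \<comment> \<open>A mirror that separates \<open>c\<close> from \<open>s x\<close> and has
    \<open>z\<close> on it or beyond it is crossed on the leg from \<open>c\<close> to
    \<open>z\<close> and is kept. Otherwise it is crossed between \<open>z\<close> and
    \<open>s x\<close>, and \<open>s\<close> pulls it back to one crossed between \<open>z\<close>
    and \<open>x\<close>.\<close>
  define \<phi> where "\<phi> p = (if h p z \<le> 0 then p else f p)" for p
  have "\<phi> p \<in> separating c x - {(\<alpha>, k)}" if p: "p \<in> separating c (s x)" for p
  proof (cases "h p z \<le> 0")
    case True
    have "(1 - t) * h p c > 0" using p t by (simp add: sep)
    then have "t * h p x < 0" using True hz[of p] by linarith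
    then have "h p x < 0" using t by (simp add: mult_less_0_iff)
    moreover have "h (\<alpha>, k) (s x) > 0"
      using a inner_reflection[OF root_nonzero[OF a(1)], of "of_int k" x] by (simp add: h_def s_def)
    ultimately show ?thesis using True p by (auto simp: \<phi>_def sep)
  next
    case False
    have pR: "fst p \<in> R" using p by (simp add: sep)
    have "h (f p) z > 0" using False pR by (simp add: hf sz)
    moreover have "h (f p) x < 0" using p pR by (simp add: hf sep)
    ultimately have "(1 - t) * h (f p) c > 0"
      using t hz[of "f p"] mult_pos_neg[of t "h (f p) x"] by linarith
    then have "h (f p) c > 0" using t by (simp add: zero_less_mult_iff)
    then show ?thesis
      using False \<open>h (f p) x < 0\<close> \<open>h (f p) z > 0\<close> f[OF pR] z by (auto simp: \<phi>_def sep)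
  qed
  then have "\<phi> ` separating c (s x) \<subseteq> separating c x - {(\<alpha>, k)}" by (intro image_subsetI)
  moreover have "inj_on \<phi> (separating c (s x))"
  proof (rule inj_onI)
    fix p q assume pq: "p \<in> separating c (s x)" "q \<in> separating c (s x)" "\<phi> p = \<phi> q"
    then have R: "fst p \<in> R" "fst q \<in> R" by (simp_all add: sep)
    \<comment> \<open>Since \<open>s\<close> fixes \<open>z\<close>, the value at \<open>z\<close>
      survives \<phi>, so elements with equal images fall under the same case of its
      definition.\<close>
    have "h (\<phi> p) z = h p z" "h (\<phi> q) z = h q z" using R by (simp_all add: \<phi>_def hf sz)
    then have "h p z = h q z" using pq(3) by simp
    then consider "p = q" | "f p = f q" using pq(3) by (cases "h p z \<le> 0") (simp_all add: \<phi>_def)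
    then show "p = q"
    proof cases
      case 2
      have h: "h p y = h q y" for y
        using hf[OF R(1), of "s y"] hf[OF R(2), of "s y"] unfolding ss 2 by (rule trans[OF sym])
      have snd: "snd p = snd q" using h[of 0] by (simp add: h_def)
      have "fst p \<bullet> y = fst q \<bullet> y" for y using h[of y] snd by (simp add: h_def)
      then have "fst p \<bullet> (fst p - fst q) = fst q \<bullet> (fst p - fst q)" by blast
      then have "(fst p - fst q) \<bullet> (fst p - fst q) = 0" by (simp add: inner_diff_left)
      then have "fst p = fst q" by simp
      then show "p = q" using snd by (simp add: prod_eq_iff)
    qed
  qed
  ultimately have "card (separating c (s x)) \<le> card (separating c x - {(\<alpha>, k)})"
    using card_inj_on_le finite_separating by (metis finite_Diff)
  also have "\<dots> < card (separating c x)"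
    using assms finite_separating by (intro card_Diff1_less)
  finally show ?thesis unfolding s_def .
qed

text \<open>Induction on the number of separating affine roots: outside the closed alcove there is
  one, and reflecting in it decreases their number.\<close>

lemma ex_translate_closure_alcove: "\<exists>u\<in>Waff. act u x \<in> closure C"
proof -
  obtain c where c: "c \<in> C" using alcove_nonempty by blast
  show ?thesis
  proof (induction "card (separating c x)" arbitrary: x rule: less_induct)
    case less
    show ?case
    proof (cases "x \<in> closure C")
      case True
      then show ?thesis by (intro bexI[of _ "\<one>\<^bsub>W\<^esub>"]) (simp_all add: act_one)
    next
      case False
      then obtain \<alpha> k where a: "\<alpha> \<in> R" "\<alpha> \<bullet> c + of_int k > 0" "\<alpha> \<bullet> x + of_int k < 0"
        unfolding in_closure_alcove_iff[OF c] by force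
      obtain r where r: "r \<in> Waff" "act r = reflection \<alpha> (of_int k)"
        using ex_root_reflection[OF a(1)] by metis
      have "(\<alpha>, k) \<in> separating c x" using a by (simp add: separating_def)
      then obtain u where "u \<in> Waff" "act u (act r x) \<in> closure C"
        using less separating_reflection r(2) by metis
      then show ?thesis using r by (intro bexI[of _ "u \<cdot> r"]) (simp_all add: act_mult Waff_carrier)
    qed
  qed
qed

text \<open>Take the shortest \<open>v\<close> such that \<open>x\<close> lies in the closure of
  \<open>v C\<close>. A first letter \<open>s\<close> of \<open>v\<close> has \<open>v C\<close> on
  its negative side, so \<open>x\<close> is on the wall of \<open>s\<close> and is fixed by
  \<open>s\<close>; then \<open>s \<cdot> v\<close> is a shorter choice. Hence \<open>v\<close> is
  trivial.\<close>

lemma in_closure_alcove_if_walls: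
  assumes walls: "\<And>s. s \<in> S \<Longrightarrow> \<exists>\<alpha> k. wall_form s \<alpha> k \<and> \<alpha> \<bullet> x + of_int k \<ge> 0"
  shows "x \<in> closure C"
proof -
  let ?P = "\<lambda>v. v \<in> Waff \<and> act (inv\<^bsub>W\<^esub> v) x \<in> closure C"
  have "\<exists>v. ?P v"
    using ex_translate_closure_alcove[of x] by (metis N.m_inv_closed W.inv_inv Waff_carrier)
  then obtain v where v: "?P v" and min: "\<And>v'. ?P v' \<Longrightarrow> len v \<le> len v'"
    using ex_has_least_nat[of ?P _ len] by metis
  have "v = \<one>\<^bsub>W\<^esub>"
  proof (rule ccontr)
    assume "v \<noteq> \<one>\<^bsub>W\<^esub>"
    then obtain s where s: "s \<in> S" "len (s \<cdot> v) < len v" using first_letter v by metis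
    obtain \<alpha> k where a: "wall_form s \<alpha> k" "\<alpha> \<bullet> x + of_int k \<ge> 0" using walls[OF s(1)] by blast
    have vc: "v \<in> carrier W" using v by (simp add: Waff_carrier)
    have "\<forall>y\<in>C. \<alpha> \<bullet> act v y + of_int k \<le> 0"
      using neg_if_len_le[OF s(1) a(1) vc] s(2) by (simp add: less_imp_le)
    from closure_alcove_sign(2)[OF vc _ this, of "act (inv\<^bsub>W\<^esub> v) x"] v
    have "\<alpha> \<bullet> x + of_int k = 0" using a(2) vc by (simp add: act_inv)
    then have "act s x = x" by (simp add: wall_formD(3)[OF a(1)] reflection_fixes)
    then have "?P (s \<cdot> v)"
      using v vc s(1) by (simp add: W.inv_mult_group S_carrier S_Waff S_inv act_mult)
    then show False using min s(2) by fastforce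
  qed
  then show ?thesis using v by (simp add: act_one)
qed

text \<open>The floor of \<beta> at \<open>c\<close> gives two consecutive parallel hyperplanes that
  enclose the alcove in a strip.\<close>

lemma alcove_width:
  assumes b: "\<beta> \<in> R" and x: "x \<in> closure C" "y \<in> closure C"
  shows "\<bar>\<beta> \<bullet> x - \<beta> \<bullet> y\<bar> \<le> 1"
proof -
  obtain c where c: "c \<in> C" using alcove_nonempty by blast
  have "\<beta> \<bullet> c + of_int (- \<lfloor>\<beta> \<bullet> c\<rfloor>) \<ge> 0" by simp
  then have 1: "\<beta> \<bullet> c + of_int (- \<lfloor>\<beta> \<bullet> c\<rfloor>) > 0"
    using alcove_sign[OF b, of "- \<lfloor>\<beta> \<bullet> c\<rfloor>"] c by (meson not_less)
  have 2: "(- \<beta>) \<bullet> c + of_int (\<lfloor>\<beta> \<bullet> c\<rfloor> + 1) > 0" by simp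
  have "0 \<le> \<beta> \<bullet> z - of_int \<lfloor>\<beta> \<bullet> c\<rfloor> \<and> \<beta> \<bullet> z - of_int \<lfloor>\<beta> \<bullet> c\<rfloor> \<le> 1" if "z \<in> closure C" for z
  proof -
    have "\<beta> \<bullet> z + of_int (- \<lfloor>\<beta> \<bullet> c\<rfloor>) \<ge> 0" "(- \<beta>) \<bullet> z + of_int (\<lfloor>\<beta> \<bullet> c\<rfloor> + 1) \<ge> 0"
      using that 1 2 b root_minus[OF b] unfolding in_closure_alcove_iff[OF c] by blast+
    then show ?thesis by simp
  qed
  from this[OF x(1)] this[OF x(2)] show ?thesis by linarith
qed

text \<open>A wall meets the closed alcove, so the strip bound leaves finitely many offsets for each
  of the finitely many roots.\<close>

lemma finite_S: "finite S"
proof -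
  obtain c where c: "c \<in> C" using alcove_nonempty by blast
  let ?P = "SIGMA \<alpha>:R. {\<lfloor>- (\<alpha> \<bullet> c)\<rfloor>..\<lceil>- (\<alpha> \<bullet> c)\<rceil> + 1}"
  have "act s \<in> (\<lambda>(\<alpha>, k). reflection \<alpha> (of_int k)) ` ?P" if s: "s \<in> S" for s
  proof -
    obtain \<alpha> k where a: "wall_form s \<alpha> k" using ex_wall_form[OF s] by metis
    \<comment> \<open>The point only shows that the hyperplane is nonempty; since it is the affine
      hull of its part in the closed alcove, that part is nonempty too.\<close>
    have "- (of_int k / (\<alpha> \<bullet> \<alpha>)) *\<^sub>R \<alpha> \<in> affine_hyperplane \<alpha> k"
      using wall_formD(2)[OF a] by (simp add: affine_hyperplane_def)
    then have "affine_hyperplane \<alpha> k \<inter> closure C \<noteq> {}"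
      using a unfolding wall_form_def walls_def by auto
    then obtain y where "y \<in> closure C" "\<alpha> \<bullet> y + of_int k = 0"
      by (auto simp: affine_hyperplane_def)
    moreover have "c \<in> closure C" using c closure_subset by blast
    ultimately have "\<bar>- of_int k - \<alpha> \<bullet> c\<bar> \<le> 1"
      using alcove_width[OF wall_formD(1)[OF a], of y c] by (simp add: eq_neg_iff_add_eq_0)
    then have "k \<in> {\<lfloor>- (\<alpha> \<bullet> c)\<rfloor>..\<lceil>- (\<alpha> \<bullet> c)\<rceil> + 1}"
      using wall_formD(4)[OF a c] by (simp; linarith)
    then show ?thesis using a unfolding wall_form_def by force
  qed
  moreover have "finite ?P" using finite_roots by auto
  moreover have "inj_on act S"
    using Waff_faithful S_Waff by (metis inj_onI)
  ultimately show ?thesis by (meson finite_imageI finite_subset image_subsetI inj_on_finite)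
qed

text \<open>Forms of walls through \<open>y\<close> do not decrease along \<open>v\<close>, and the
  other wall forms are positive at \<open>y\<close> and stay so for small \<open>t\<close>.
  Finiteness of \<open>S\<close> gives one \<open>t\<close> for all walls.\<close>

lemma closure_alcove_move:
  assumes y: "y \<in> closure C"
    and v: "\<And>s \<alpha> k. s \<in> S \<Longrightarrow> wall_form s \<alpha> k \<Longrightarrow> \<alpha> \<bullet> y + of_int k = 0 \<Longrightarrow> \<alpha> \<bullet> v \<ge> 0"
  shows "\<exists>t>0. y + t *\<^sub>R v \<in> closure C"
proof -
  have "\<forall>\<^sub>F t in at_right 0. \<exists>\<alpha> k. wall_form s \<alpha> k \<and> \<alpha> \<bullet> (y + t *\<^sub>R v) + of_int k \<ge> 0" if s: "s \<in> S" for s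
  proof -
    obtain \<alpha> k where a: "wall_form s \<alpha> k" using ex_wall_form[OF s] by metis
    have "\<forall>\<^sub>F t in at_right 0. \<alpha> \<bullet> (y + t *\<^sub>R v) + of_int k \<ge> 0"
    proof (cases "\<alpha> \<bullet> y + of_int k = 0")
      case True
      have "\<alpha> \<bullet> (y + t *\<^sub>R v) + of_int k = t * (\<alpha> \<bullet> v)" for t
        using True by (simp add: inner_add_right)
      then show ?thesis using v[OF s a True] eventually_at_right_less[of "0::real"]
        by (auto elim: eventually_mono)
    next
      case False
      then have "\<alpha> \<bullet> y + of_int k > 0" using wall_formD(5)[OF a y] by simp
      moreover have "((\<lambda>t. \<alpha> \<bullet> (y + t *\<^sub>R v) + of_int k) \<longlongrightarrow> \<alpha> \<bullet> (y + 0 *\<^sub>R v) + of_int k) (at_right 0)"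
        by (intro tendsto_intros)
      ultimately have "\<forall>\<^sub>F t in at_right 0. \<alpha> \<bullet> (y + t *\<^sub>R v) + of_int k > 0"
        by (intro order_tendstoD(1)) auto
      then show ?thesis by (auto elim: eventually_mono)
    qed
    then show ?thesis using a by (blast intro: eventually_mono)
  qed
  then have "\<forall>\<^sub>F t in at_right (0::real). \<forall>s\<in>S. \<exists>\<alpha> k. wall_form s \<alpha> k \<and> \<alpha> \<bullet> (y + t *\<^sub>R v) + of_int k \<ge> 0"
    using finite_S by (intro eventually_ball_finite) auto
  then have "\<forall>\<^sub>F t in at_right (0::real). t > 0 \<and> y + t *\<^sub>R v \<in> closure C"
    using eventually_at_right_less[of "0::real"]
    by eventually_elim (simp add: in_closure_alcove_if_walls)
  then show ?thesis using eventually_happens[of _ "at_right (0::real)"] by force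
qed

lemma alcove_move:
  assumes "c \<in> C"
  shows "\<exists>t>0. c + t *\<^sub>R z \<in> closure C"
  using assms wall_formD(4) closure_subset
  by (intro closure_alcove_move) (blast, fastforce)

section \<open>Compactness modulo the directions orthogonal to the roots\<close>

lemma closure_alcove_bounded_form:
  assumes "v \<in> span R"
  shows "\<exists>m. \<forall>x\<in>closure C. \<bar>v \<bullet> x\<bar> \<le> m"
proof -
  obtain c where "c \<in> C" using alcove_nonempty by blast
  then have c: "c \<in> closure C" using closure_subset by blast
  show ?thesis using assms
  proof (induction rule: span_induct_alt)
    case base
    then show ?case by auto
  next
    case (step a \<alpha> v)
    then obtain m where m: "\<forall>x\<in>closure C. \<bar>v \<bullet> x\<bar> \<le> m" by blast
    have "\<bar>(a *\<^sub>R \<alpha> + v) \<bullet> x\<bar> \<le> \<bar>a\<bar> * (\<bar>\<alpha> \<bullet> c\<bar> + 1) + m" if "x \<in> closure C" for x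
    proof -
      have "\<bar>\<alpha> \<bullet> x\<bar> \<le> \<bar>\<alpha> \<bullet> c\<bar> + 1" using alcove_width[OF step(1) that c] by linarith
      then have "\<bar>a * (\<alpha> \<bullet> x)\<bar> \<le> \<bar>a\<bar> * (\<bar>\<alpha> \<bullet> c\<bar> + 1)"
        by (simp add: abs_mult mult_left_mono)
      then show ?thesis using m that by (fastforce simp: inner_add_left)
    qed
    then show ?case by blast
  qed
qed

text \<open>Orthogonal projection to the span of the roots changes no affine root, so it maps the
  closed alcove into itself, and the coordinates of its image are bounded.\<close>

lemma ex_compact_representatives:
  obtains K where "compact K" "K \<subseteq> closure C"
    "\<And>x. x \<in> closure C \<Longrightarrow> \<exists>y\<in>K. \<forall>\<alpha>\<in>R. \<alpha> \<bullet> (x - y) = 0"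
proof -
  obtain B where B: "finite B" "span B = span R" "pairwise orthogonal B"
    using basis_orthogonal[OF finite_roots] by metis
  \<comment> \<open>\<open>B\<close> may contain 0; division by zero then gives coefficient 0 and
    bound 0, so no case distinction is needed.\<close>
  define p where "p x = (\<Sum>b\<in>B. ((b \<bullet> x) / (b \<bullet> b)) *\<^sub>R b)" for x
  have B0: "b \<bullet> (x - p x) = 0" if b: "b \<in> B" for b x
  proof -
    have "b \<bullet> p x = (\<Sum>a\<in>B. if a = b then b \<bullet> x else 0)"
      unfolding p_def inner_sum_right using B(3) b
      by (intro sum.cong) (auto simp: pairwise_def orthogonal_def)
    then show ?thesis using B(1) b by (simp add: inner_diff_right)
  qed
  have ort: "v \<bullet> (x - p x) = 0" if "v \<in> span B" for v x
    using that(1)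
    by (induction v rule: span_induct_alt) (simp_all add: inner_add_left B0)
  then have R: "\<alpha> \<bullet> (x - p x) = 0" if "\<alpha> \<in> R" for \<alpha> x
    using that B(2) span_base by metis
  have "\<forall>b\<in>B. \<exists>m. \<forall>x\<in>closure C. \<bar>b \<bullet> x\<bar> \<le> m"
    using closure_alcove_bounded_form B(2) span_base by metis
  then obtain M where M: "\<And>b x. b \<in> B \<Longrightarrow> x \<in> closure C \<Longrightarrow> \<bar>b \<bullet> x\<bar> \<le> M b" by metis
  let ?K = "closure C \<inter> {\<Sum>b\<in>B. f b *\<^sub>R b | f. \<forall>b\<in>B. \<bar>f b\<bar> \<le> M b / (b \<bullet> b)}"
  show thesis
  proof (rule that[of ?K])
    show "compact ?K" using compact_box[OF B(1)] by (intro closed_Int_compact) auto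
    fix x assume x: "x \<in> closure C"
    have "\<bar>(b \<bullet> x) / (b \<bullet> b)\<bar> \<le> M b / (b \<bullet> b)" if "b \<in> B" for b
      using M[OF that x] by (simp add: abs_divide divide_right_mono)
    then have "p x \<in> {\<Sum>b\<in>B. f b *\<^sub>R b | f. \<forall>b\<in>B. \<bar>f b\<bar> \<le> M b / (b \<bullet> b)}"
      unfolding p_def by (intro CollectI exI[of _ "\<lambda>b. (b \<bullet> x) / (b \<bullet> b)"]) simp
    moreover have "p x \<in> closure C"
    proof -
      have "\<alpha> \<bullet> p x = \<alpha> \<bullet> x" if "\<alpha> \<in> R" for \<alpha> using R[OF that, of x] by (simp add: inner_diff_right)
      moreover obtain c where "c \<in> C" using alcove_nonempty by blast
      ultimately show ?thesis using x by (simp add: in_closure_alcove_iff)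
    qed
    ultimately show "\<exists>y\<in>?K. \<forall>\<alpha>\<in>R. \<alpha> \<bullet> (x - y) = 0" using R by blast
  qed auto
qed

subsection \<open>The displacement function\<close>

definition displacement :: "'w \<Rightarrow> 'v \<Rightarrow> real" where
  "displacement w y = (act w y - y) \<bullet> (act w y - y)"

text \<open>Half of the gradient of \<open>displacement w\<close>.\<close>

definition gradient :: "'w \<Rightarrow> 'v \<Rightarrow> 'v" where
  "gradient w y = 2 *\<^sub>R y - act w y - act (inv\<^bsub>W\<^esub> w) y"

text \<open>With \<open>L\<close> orthogonal and \<open>act w y - y = L (y - act (inv w) y)\<close>,
  the mixed term becomes a product with \<open>gradient w y\<close>. The remainder is a square,
  which makes the displacement convex.\<close>

lemma displacement_expansion:
  assumes w: "w \<in> carrier W"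
  obtains L a where "linear L" "\<And>x. act w x = L x + a"
    "\<And>y z. displacement w (y + z) =
      displacement w y + 2 * (gradient w y \<bullet> z) + (L z - z) \<bullet> (L z - z)"
proof -
  obtain L a where L: "linear L" "\<And>x y. L x \<bullet> L y = x \<bullet> y" "\<And>x. act w x = L x + a"
    using rigid_motionE[OF rigid_motion_act[OF w]] by metis
  have "displacement w (y + z) =
      displacement w y + 2 * (gradient w y \<bullet> z) + (L z - z) \<bullet> (L z - z)" for y z
  proof -
    let ?y' = "act (inv\<^bsub>W\<^esub> w) y"
    let ?d = "act w y - y"
    have "L ?y' = y - a" using L(3)[of ?y'] w by (simp add: act_inv eq_diff_eq)
    then have d: "?d = L (y - ?y')" by (simp add: L(3) linear_diff[OF L(1)])
    have "?d \<bullet> (L z - z) = L (y - ?y') \<bullet> L z - ?d \<bullet> z"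
      by (subst d[symmetric]) (simp add: inner_diff_right)
    then have "?d \<bullet> (L z - z) = gradient w y \<bullet> z"
      by (simp add: L(2) gradient_def inner_diff_left)
    moreover have "act w (y + z) - (y + z) = ?d + (L z - z)"
      by (simp add: L(3) linear_add[OF L(1)])
    then have "displacement w (y + z) = displacement w y + 2 * (?d \<bullet> (L z - z)) + (L z - z) \<bullet> (L z - z)"
      unfolding displacement_def
      by (simp only: inner_add_left inner_add_right inner_commute[of "L z - z" ?d])
    ultimately show ?thesis by simp
  qed
  then show thesis using that L by blast
qed

lemma displacement_invariant:
  assumes w: "w \<in> carrier W" and "\<And>\<alpha>. \<alpha> \<in> R \<Longrightarrow> \<alpha> \<bullet> (x - y) = 0"
  shows "displacement w x = displacement w y"
proof -
  obtain L a where L: "linear L" "L (x - y) = x - y" "\<And>x. act w x = L x + a"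
    using rigid_motionE[OF rigid_motion_act[OF w]] assms(2) by (metis (no_types, lifting))
  have "act w x - x = act w y - y"
    using L(2) by (simp add: L(3) linear_diff[OF L(1)]) (simp add: algebra_simps)
  then show ?thesis by (simp add: displacement_def)
qed

text \<open>The maximum over the compact set \<open>K\<close> is one over the whole closed alcove,
  because displacement ignores directions orthogonal to the roots.\<close>

lemma displacement_has_max:
  assumes w: "w \<in> carrier W"
  obtains y where "y \<in> closure C" "\<And>x. x \<in> closure C \<Longrightarrow> displacement w x \<le> displacement w y"
proof -
  obtain K where K: "compact K" "K \<subseteq> closure C"
    "\<And>x. x \<in> closure C \<Longrightarrow> \<exists>y\<in>K. \<forall>\<alpha>\<in>R. \<alpha> \<bullet> (x - y) = 0"
    using ex_compact_representatives by metis
  have ne: "K \<noteq> {}" using K(3) alcove_nonempty closure_subset[of C] by blast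
  have "continuous_on K (displacement w)"
    unfolding displacement_def
    by (intro continuous_intros rigid_motion_continuous[OF rigid_motion_act[OF w]])
  then obtain y where y: "y \<in> K" "\<forall>x\<in>K. displacement w x \<le> displacement w y"
    using continuous_attains_sup[OF K(1) ne] by metis
  have "displacement w x \<le> displacement w y" if "x \<in> closure C" for x
    using K(3)[OF that] displacement_invariant[OF w] y(2) by metis
  then show thesis using that y(1) K(2) by blast
qed

text \<open>Without the linear term the expansion exceeds its value at \<open>y\<close> by a square,
  so maximality makes \<open>L\<close> fix \<open>x - y\<close> for every \<open>x\<close> in the
  closed alcove.\<close>

lemma translation_if_displacement_max:
  assumes w: "w \<in> carrier W" and y: "y \<in> closure C" and g: "gradient w y = 0"
    and max: "\<And>x. x \<in> closure C \<Longrightarrow> displacement w x \<le> displacement w y"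
  shows "w \<in> translation_subgroup W act"
proof -
  obtain L a where L: "linear L" "\<And>x. act w x = L x + a"
    "\<And>y z. displacement w (y + z) =
      displacement w y + 2 * (gradient w y \<bullet> z) + (L z - z) \<bullet> (L z - z)"
    using displacement_expansion[OF w] by metis
  have fix1: "L (x - y) = x - y" if "x \<in> closure C" for x
  proof -
    have "(L (x - y) - (x - y)) \<bullet> (L (x - y) - (x - y)) \<le> 0"
      using max[OF that] L(3)[of y "x - y"] g by simp
    then have "L (x - y) - (x - y) = 0" by (metis inner_ge_zero inner_eq_zero_iff order_antisym)
    then show ?thesis by simp
  qed
  obtain c where c: "c \<in> C" using alcove_nonempty by blast
  have "L z = z" for z
  proof -
    \<comment> \<open>The differences of such vectors fill every direction: both
      \<open>c - y\<close> and \<open>c + t *\<^sub>R z - y\<close> are fixed, hence so is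
      \<open>z\<close>.\<close>
    obtain t where t: "t > 0" "c + t *\<^sub>R z \<in> closure C" using alcove_move[OF c] by metis
    have "L (c - y) = c - y" using c closure_subset by (intro fix1) blast
    then have "L ((c + t *\<^sub>R z - y) - (c - y)) = (c + t *\<^sub>R z - y) - (c - y)"
      using linear_diff[OF L(1), of "c + t *\<^sub>R z - y" "c - y"] fix1[OF t(2)] by presburger
    then have "L (t *\<^sub>R z) = t *\<^sub>R z" by simp
    then show ?thesis using t(1) by (simp add: linear_scale[OF L(1)])
  qed
  then show ?thesis using w L(2) unfolding translation_subgroup_def by auto
qed

lemma displacement_conj:
  assumes s: "s \<in> S" "act s y = y" and w: "w \<in> carrier W"
  shows "displacement (s \<cdot> w \<cdot> s) y = displacement w y"
proof -
  have "act (s \<cdot> w \<cdot> s) y = act s (act w y)" using s w by (simp add: act_mult S_carrier)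
  then have "dist (act (s \<cdot> w \<cdot> s) y) y = dist (act s (act w y)) (act s y)" using s by simp
  also have "\<dots> = dist (act w y) y"
    by (rule rigid_motion_dist[OF rigid_motion_act[OF S_carrier[OF s(1)]]])
  finally show ?thesis
    by (simp add: displacement_def dist_norm dot_square_norm)
qed

text \<open>Seen from its fixed point \<open>y\<close>, the reflection \<open>s\<close> is linear,
  and the gradient is a linear expression in the two displacement vectors at
  \<open>y\<close>.\<close>

lemma gradient_conj:
  assumes s: "s \<in> S" "wall_form s \<alpha> k" and y: "\<alpha> \<bullet> y + of_int k = 0" and w: "w \<in> carrier W"
  shows "gradient (s \<cdot> w \<cdot> s) y = reflection \<alpha> 0 (gradient w y)"
proof -
  have sy: "act s y = y" using y by (simp add: wall_formD(3)[OF s(2)] reflection_fixes)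
  have sx: "act s x = y + reflection \<alpha> 0 (x - y)" for x
    using y by (simp add: wall_formD(3)[OF s(2)] reflection_def inner_diff_right)
  have "inv\<^bsub>W\<^esub> (s \<cdot> w \<cdot> s) = s \<cdot> inv\<^bsub>W\<^esub> w \<cdot> s"
    using s w by (simp add: W.inv_mult_group S_carrier S_inv W.m_assoc)
  then have "gradient (s \<cdot> w \<cdot> s) y = 2 *\<^sub>R y - act s (act w y) - act s (act (inv\<^bsub>W\<^esub> w) y)"
    using s w sy by (simp add: gradient_def act_mult S_carrier)
  also have "\<dots> = - reflection \<alpha> 0 (act w y - y) - reflection \<alpha> 0 (act (inv\<^bsub>W\<^esub> w) y - y)"
    unfolding sx by (simp add: scaleR_2)
  also have "\<dots> = reflection \<alpha> 0 (gradient w y)"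
  proof -
    have "- r a - r b = r (2 *\<^sub>R y - a' - b')" if "linear r" "a = a' - y" "b = b' - y"
      for r :: "'v \<Rightarrow> 'v" and a b a' b'
      using that by (simp add: linear_diff linear_scale scaleR_2 linear_add)
    then show ?thesis using linear_reflection unfolding gradient_def by blast
  qed
  finally show ?thesis .
qed

subsection \<open>Length-preserving conjugation\<close>

text \<open>The condition on prefixes is that of the theorem to be proved, so a member carries the
  required word with it.\<close>

definition length_class :: "'w \<Rightarrow> 'w set" where
  "length_class w = {conj_word W ss w | ss. set ss \<subseteq> S \<and>
     (\<forall>i\<in>{1..length ss}. len (conj_word W (take i ss) w) = len w)}"

lemma conj_word_eq: "set ss \<subseteq> S \<Longrightarrow> conj_word W ss w = inv\<^bsub>W\<^esub> (word W ss) \<cdot> w \<cdot> word W ss"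
  by (simp add: conj_word_def word_rev)

lemma length_class_refl:
  assumes "w \<in> carrier W"
  shows "w \<in> length_class w"
  unfolding length_class_def using assms
  by (intro CollectI exI[of _ "[]"]) (simp add: conj_word_eq word_Nil)

lemma length_classD:
  assumes w: "w \<in> carrier W" and x: "x \<in> length_class w"
  shows "x \<in> carrier W" "len x = len w"
    and "x \<in> translation_subgroup W act \<Longrightarrow> w \<in> translation_subgroup W act"
proof -
  obtain ss where ss: "set ss \<subseteq> S" "x = conj_word W ss w"
    "\<forall>i\<in>{1..length ss}. len (conj_word W (take i ss) w) = len w"
    using x unfolding length_class_def by blast
  let ?u = "word W ss"
  have u: "?u \<in> carrier W" using ss by (simp add: word_Waff Waff_carrier)
  have xe: "x = inv\<^bsub>W\<^esub> ?u \<cdot> w \<cdot> ?u" using ss by (simp add: conj_word_eq)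
  show "x \<in> carrier W" using xe u w by simp
  show "len x = len w"
  \<comment> \<open>The range of prefixes starts at 1 and is empty for the empty word.\<close>
  proof (cases "ss = []")
    case True
    then show ?thesis using ss(2) w by (simp add: conj_word_eq word_Nil)
  next
    case False
    then have "length ss \<in> {1..length ss}" by (simp add: Suc_le_eq)
    from bspec[OF ss(3) this] show ?thesis using ss(2) by simp
  qed
  have "?u \<cdot> x = w \<cdot> ?u" using u w by (simp add: xe W.m_assoc[symmetric])
  then have "?u \<cdot> x \<cdot> inv\<^bsub>W\<^esub> ?u = w" using u w by (simp add: W.m_assoc)
  moreover have "translation_subgroup W act \<lhd> W" using decomp_translations by (simp add: semidirect_def)
  ultimately show "w \<in> translation_subgroup W act" if "x \<in> translation_subgroup W act"
    using that u normal.inv_op_closed2 by metis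
qed

lemma length_class_step:
  assumes w: "w \<in> carrier W" and x: "x \<in> length_class w" and s: "s \<in> S"
    and len: "len (s \<cdot> x \<cdot> s) = len w"
  shows "s \<cdot> x \<cdot> s \<in> length_class w"
proof -
  obtain ss where ss: "set ss \<subseteq> S" "x = conj_word W ss w"
    "\<forall>i\<in>{1..length ss}. len (conj_word W (take i ss) w) = len w"
    using x unfolding length_class_def by blast
  have e: "conj_word W (ss @ [s]) w = s \<cdot> x \<cdot> s"
    using ss s w unfolding conj_word_def
    by (simp add: word_append word_Cons word_Nil W.m_assoc S_carrier word_Waff Waff_carrier)
  have "len (conj_word W (take i (ss @ [s])) w) = len w" if "i \<in> {1..length (ss @ [s])}" for i
    using that ss(3) e len by (cases "i \<le> length ss") (auto simp: le_Suc_eq)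
  then show ?thesis unfolding length_class_def using e ss s
    by (intro CollectI exI[of _ "ss @ [s]"]) auto
qed

text \<open>The stabilizer of \<open>C\<close> may be infinite, but conjugation by
  \<open>Waff\<close> does not leave the coset of \<open>Waff\<close> through \<tau>. Hence members
  are \<open>v \<cdot> \<tau>\<close> with \<tau> fixed and \<open>v\<close> a word of length
  \<open>len w\<close> in a finite alphabet.\<close>

lemma finite_length_class:
  assumes w: "w \<in> carrier W"
  shows "finite (length_class w)"
proof -
  obtain a \<tau> where d: "a \<in> Waff" "\<tau> \<in> carrier W" "act \<tau> ` C = C" "w = a \<cdot> \<tau>"
    using alcove_decomposition[OF w] by metis
  let ?V = "{word W ss | ss. set ss \<subseteq> S \<and> length ss = len w}"
  have "x \<in> (\<lambda>v. v \<cdot> \<tau>) ` ?V" if x: "x \<in> length_class w" for x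
  proof -
    obtain ss where ss: "set ss \<subseteq> S" "x = conj_word W ss w"
      using x unfolding length_class_def by blast
    let ?u = "word W ss"
    let ?v = "inv\<^bsub>W\<^esub> ?u \<cdot> a \<cdot> (\<tau> \<cdot> ?u \<cdot> inv\<^bsub>W\<^esub> \<tau>)"
    have u: "?u \<in> Waff" using ss by (simp add: word_Waff)
    have v: "?v \<in> Waff" using u d by (simp add: N.inv_op_closed2)
    have xv: "x = ?v \<cdot> \<tau>"
      using ss u d by (simp add: conj_word_eq W.m_assoc Waff_carrier)
    then have "word_length W S ?v = len w"
      using length_classD(2)[OF w x] len_decomposition[OF v d(2,3)] by simp
    moreover obtain ts where "set ts \<subseteq> S" "?v = word W ts" "length ts = word_length W S ?v"
      using reduced_word[OF v] by metis
    ultimately have "?v \<in> ?V" by (intro CollectI exI[of _ ts]) simp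
    then show ?thesis using xv by (rule rev_image_eqI)
  qed
  then have "length_class w \<subseteq> (\<lambda>v. v \<cdot> \<tau>) ` ?V" by (rule subsetI)
  then show ?thesis using finite_generating_words[OF finite_S] by (meson finite_imageI finite_subset)
qed

text \<open>Positivity makes \<open>s \<cdot> x\<close> or \<open>x \<cdot> s\<close> longer than
  \<open>x\<close>. If both are longer, then \<open>s \<cdot> x \<cdot> s = x\<close> by
  \<open>no_rise\<close>. Otherwise one is longer and one shorter, and
  \<open>s \<cdot> x \<cdot> s\<close> is within one of each, so its length is that of
  \<open>x\<close>.\<close>

lemma length_class_step_if_pos:
  assumes w: "w \<in> carrier W" and x: "x \<in> length_class w" and s: "s \<in> S" "wall_form s \<alpha> k"
    and no_rise: "\<not> (len (s \<cdot> x) > len x \<and> len (x \<cdot> s) > len x \<and> s \<cdot> x \<cdot> s \<noteq> x)"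
    and pos: "(\<forall>y\<in>C. \<alpha> \<bullet> act x y + of_int k > 0) \<or> (\<forall>y\<in>C. \<alpha> \<bullet> act (inv\<^bsub>W\<^esub> x) y + of_int k > 0)"
  shows "s \<cdot> x \<cdot> s \<in> length_class w"
proof -
  have xc: "x \<in> carrier W" "len x = len w" using length_classD[OF w x] by auto
  have sx: "s \<cdot> x \<in> carrier W" "x \<cdot> s \<in> carrier W" using xc s by (simp_all add: S_carrier)
  have assoc: "s \<cdot> x \<cdot> s = s \<cdot> (x \<cdot> s)" using xc s by (simp add: W.m_assoc S_carrier)
  have cancel: "s \<cdot> x \<cdot> s \<cdot> s = s \<cdot> x" "s \<cdot> (s \<cdot> x \<cdot> s) = x \<cdot> s"
    using xc s by (simp_all add: W.m_assoc S_carrier S_square S_cancel)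
  have le: "len (s \<cdot> x) \<le> Suc (len (s \<cdot> x \<cdot> s))" "len (x \<cdot> s) \<le> Suc (len (s \<cdot> x \<cdot> s))"
    "len (s \<cdot> x \<cdot> s) \<le> Suc (len (s \<cdot> x))" "len (s \<cdot> x \<cdot> s) \<le> Suc (len (x \<cdot> s))"
    using len_mult_right_le[OF s(1), of "s \<cdot> x \<cdot> s"] len_mult_le[OF s(1), of "s \<cdot> x \<cdot> s"]
      len_mult_right_le[OF s(1) sx(1)] len_mult_le[OF s(1) sx(2)] sx s
    by (simp_all add: cancel S_carrier flip: assoc)
  have "len (s \<cdot> x) > len x \<or> len (x \<cdot> s) > len x"
    using pos len_greater_if_pos[OF s xc(1)] len_greater_if_pos[OF s, of "inv\<^bsub>W\<^esub> x"] xc s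
    by (auto simp: len_mult_right len_inv)
  moreover have "len (s \<cdot> x) \<noteq> len x" "len (x \<cdot> s) \<noteq> len x"
    using len_mult_neq len_mult_right_neq s xc by blast+
  ultimately consider "s \<cdot> x \<cdot> s = x" | "len (s \<cdot> x) > len x" "len (x \<cdot> s) < len x"
    | "len (s \<cdot> x) < len x" "len (x \<cdot> s) > len x"
    using no_rise by force
  then have "len (s \<cdot> x \<cdot> s) = len x" using le by cases simp_all
  then show ?thesis using length_class_step[OF w x s(1)] xc(2) by simp
qed

section \<open>Existence of a length-raising conjugate\<close>

theorem ex_length_raising_conjugate:
  assumes w: "w \<in> carrier W" and nt: "w \<notin> translation_subgroup W act"
  shows "\<exists>x\<in>length_class w. \<exists>s\<in>S.
    len (s \<cdot> x) > len x \<and> len (x \<cdot> s) > len x \<and> s \<cdot> x \<cdot> s \<noteq> x"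
proof (rule ccontr)
  assume none: "\<not> ?thesis"
  let ?X = "length_class w"
  note carrier = length_classD(1)[OF w]
  have fin: "finite ?X" by (rule finite_length_class[OF w])
  have "\<forall>x\<in>?X. \<exists>y. y \<in> closure C \<and> (\<forall>z\<in>closure C. displacement x z \<le> displacement x y)"
    using displacement_has_max carrier by metis
  then obtain m where m: "\<And>x. x \<in> ?X \<Longrightarrow> m x \<in> closure C"
    "\<And>x z. x \<in> ?X \<Longrightarrow> z \<in> closure C \<Longrightarrow> displacement x z \<le> displacement x (m x)"
    by metis
  \<comment> \<open>First choice: \<open>x0\<close> and \<open>y\<close> maximize displacement over
    class and closed alcove jointly. Here \<open>x0\<close> is a group element, not the special
    point of the locale.\<close>
  obtain x0 where x0: "x0 \<in> ?X" "\<And>x. x \<in> ?X \<Longrightarrow> displacement x (m x) \<le> displacement x0 (m x0)"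
    using finite_ex_max_image[OF fin length_class_refl[OF w], of "\<lambda>x. displacement x (m x)"] by metis
  define y where "y = m x0"
  have y: "y \<in> closure C" using m(1) x0(1) by (simp add: y_def)
  have max0: "displacement x z \<le> displacement x0 y" if "x \<in> ?X" "z \<in> closure C" for x z
    using m(2)[OF that] x0(2)[OF that(1)] by (simp add: y_def)
  obtain c where c: "c \<in> C" using alcove_nonempty by blast
  \<comment> \<open>Second choice: \<open>y\<close> is kept, and among the members with maximal
    displacement there the gradient is made to point best towards \<open>c\<close>.\<close>
  let ?Y = "{x \<in> ?X. displacement x y = displacement x0 y}"
  have "finite ?Y" "x0 \<in> ?Y" using fin x0(1) by simp_all
  then obtain x where x: "x \<in> ?Y"
    and best: "\<And>x'. x' \<in> ?Y \<Longrightarrow> gradient x' y \<bullet> (c - y) \<le> gradient x y \<bullet> (c - y)"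
    using finite_ex_max_image[of ?Y x0 "\<lambda>x. gradient x y \<bullet> (c - y)"] by blast
  define v where "v = gradient x y"
  have xX: "x \<in> ?X" and xc: "x \<in> carrier W" using x carrier by auto
  have max: "displacement x z \<le> displacement x y" if "z \<in> closure C" for z
    using max0[OF xX that] x by simp
  have "\<alpha> \<bullet> v \<ge> 0" if s: "s \<in> S" "wall_form s \<alpha> k" and h: "\<alpha> \<bullet> y + of_int k = 0" for s \<alpha> k
  proof (rule ccontr)
    assume "\<not> \<alpha> \<bullet> v \<ge> 0"
    then have neg: "\<alpha> \<bullet> v < 0" by simp
    \<comment> \<open>As \<open>y\<close> is on the wall, the first term vanishes. A negative
      product thus puts \<open>x y\<close> or \<open>inv x y\<close> strictly on the positive side,
      and with it the whole corresponding alcove.\<close>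
    have "\<alpha> \<bullet> v = 2 * (\<alpha> \<bullet> y + of_int k) - (\<alpha> \<bullet> act x y + of_int k) - (\<alpha> \<bullet> act (inv\<^bsub>W\<^esub> x) y + of_int k)"
      by (simp add: v_def gradient_def inner_diff_right)
    then have "0 < (\<alpha> \<bullet> act x y + of_int k) + (\<alpha> \<bullet> act (inv\<^bsub>W\<^esub> x) y + of_int k)"
      using neg unfolding h by simp
    then have "\<not> (\<alpha> \<bullet> act x y + of_int k \<le> 0 \<and> \<alpha> \<bullet> act (inv\<^bsub>W\<^esub> x) y + of_int k \<le> 0)"
      by (meson add_nonpos_nonpos not_less)
    then have "(\<forall>z\<in>C. \<alpha> \<bullet> act x z + of_int k > 0) \<or> (\<forall>z\<in>C. \<alpha> \<bullet> act (inv\<^bsub>W\<^esub> x) z + of_int k > 0)"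
      using alcove_side[OF xc wall_formD(1)[OF s(2)], of k]
        alcove_side[OF W.inv_closed[OF xc] wall_formD(1)[OF s(2)], of k]
        closure_alcove_sign(2)[OF xc y, of \<alpha> "of_int k"]
        closure_alcove_sign(2)[OF W.inv_closed[OF xc] y, of \<alpha> "of_int k"]
      by (meson less_imp_le)
    then have X: "s \<cdot> x \<cdot> s \<in> ?X"
      using none xX s by (intro length_class_step_if_pos[OF w xX s]) blast+
    have "act s y = y" using h by (simp add: wall_formD(3)[OF s(2)] reflection_fixes)
    then have "s \<cdot> x \<cdot> s \<in> ?Y" using X x displacement_conj[OF s(1) _ xc] by simp
    \<comment> \<open>Reflecting adds a positive multiple of \<alpha> to \<open>v\<close>, and
      \<alpha> pairs positively with \<open>c - y\<close>: the reflected gradient would be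
      better.\<close>
    from best[OF this] have "reflection \<alpha> 0 v \<bullet> (c - y) \<le> v \<bullet> (c - y)"
      by (simp add: gradient_conj[OF s h xc] v_def)
    then have "2 * (\<alpha> \<bullet> v) / (\<alpha> \<bullet> \<alpha>) * (\<alpha> \<bullet> (c - y)) \<ge> 0"
      by (simp add: reflection_def inner_diff_left)
    moreover have "\<alpha> \<bullet> (c - y) > 0"
      using wall_formD(4)[OF s(2) c] h by (simp add: inner_diff_right)
    moreover have "2 * (\<alpha> \<bullet> v) / (\<alpha> \<bullet> \<alpha>) < 0"
      using neg wall_formD(2)[OF s(2)] by (simp add: divide_neg_pos)
    ultimately show False by (meson mult_neg_pos not_less)
  qed
  then obtain t where t: "t > 0" "y + t *\<^sub>R v \<in> closure C"
    using closure_alcove_move[OF y, of v] by metis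
  obtain L a where "\<And>y z. displacement x (y + z) =
      displacement x y + 2 * (gradient x y \<bullet> z) + (L z - z) \<bullet> (L z - z)"
    using displacement_expansion[OF xc] by metis
  \<comment> \<open>The step along the gradient raises the displacement by
    \<open>2 * t * (v \<bullet> v)\<close> plus a square; maximality forces
    \<open>v = 0\<close>.\<close>
  from this[of y "t *\<^sub>R v"] max[OF t(2)]
  have "2 * (t * (v \<bullet> v)) + (L (t *\<^sub>R v) - t *\<^sub>R v) \<bullet> (L (t *\<^sub>R v) - t *\<^sub>R v) \<le> 0"
    by (simp add: v_def)
  then have "t * (v \<bullet> v) \<le> 0"
    using inner_ge_zero[of "L (t *\<^sub>R v) - t *\<^sub>R v"] by linarith
  then have "v = 0" using t(1) by (metis inner_ge_zero inner_eq_zero_iff mult_le_0_iff not_less order_antisym)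
  then have "x \<in> translation_subgroup W act"
    using translation_if_displacement_max[OF xc y] max by (simp add: v_def)
  then show False using length_classD(3)[OF w xX] nt by blast
qed

end

section \<open>Application to the Iwahori-Weyl group of \<open>G\<close>\<close>

theorem mainTheorem1:
  fixes val :: "'f::field \<Rightarrow> int"
    and G A :: "('f alg_closure^'n^'n) set"
    and OmM :: "'o monoid" and \<kappa> :: "'f alg_closure^'n^'n \<Rightarrow> 'o"
    and \<iota> :: "('f alg_closure \<Rightarrow> 'f alg_closure^'n^'n) \<Rightarrow> 'v::real_inner"
    and W :: "('f alg_closure^'n^'n) set monoid"
    and act :: "('f alg_closure^'n^'n) set \<Rightarrow> 'v \<Rightarrow> 'v"
    and Waff :: "('f alg_closure^'n^'n) set set"
    and R C :: "'v set" and x0 :: 'v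
    and w :: "('f alg_closure^'n^'n) set"
    and Delta :: "('f alg_closure^'n^'n) set set"
    and len :: "('f alg_closure^'n^'n) set \<Rightarrow> nat"
  assumes "nonarch_local_field val"
    and "connected_reductive G" and "defined_over base_field G"
    and "maximal_split_torus G A"
    and "kottwitz_hom G A OmM \<kappa>"
    and "W = iwahori_weyl_group G A OmM \<kappa>"
    and "cocharacter_space A \<iota>"
    and "bruhat_tits_action val G A OmM \<kappa> \<iota> act"
    and "iwahori_weyl_structure W act Waff R C x0"
    and "translation_subgroup W act = kottwitz_coset G A OmM \<kappa> ` carrier (levi_points G A)"
    and "Delta = simple_affine_reflections act Waff R C"
    and "len = iw_length W act Waff R C"
    and "w \<in> carrier W" and "w \<notin> translation_subgroup W act"
  shows "\<exists>s ss. s \<in> Delta \<and> set ss \<subseteq> Delta \<and>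
    (\<forall>i\<in>{1..length ss}. len (conj_word W (take i ss) w) = len w) \<and>
    (let w' = conj_word W ss w in
       len (s \<otimes>\<^bsub>W\<^esub> w') > len w' \<and> len (w' \<otimes>\<^bsub>W\<^esub> s) > len w' \<and>
       s \<otimes>\<^bsub>W\<^esub> w' \<otimes>\<^bsub>W\<^esub> s \<noteq> w')"
proof -
  interpret iwahori_weyl_structure W act Waff R C x0 by fact
  obtain w' s where w': "w' \<in> length_class w" and s: "s \<in> simple_affine_reflections act Waff R C"
      "len (s \<otimes>\<^bsub>W\<^esub> w') > len w'" "len (w' \<otimes>\<^bsub>W\<^esub> s) > len w'"
      "s \<otimes>\<^bsub>W\<^esub> w' \<otimes>\<^bsub>W\<^esub> s \<noteq> w'"
    using ex_length_raising_conjugate[OF \<open>w \<in> carrier W\<close> \<open>w \<notin> translation_subgroup W act\<close>]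
    unfolding \<open>len = iw_length W act Waff R C\<close> by blast
  then obtain ss where "set ss \<subseteq> Delta" "w' = conj_word W ss w"
      "\<forall>i\<in>{1..length ss}. len (conj_word W (take i ss) w) = len w"
    unfolding length_class_def \<open>len = iw_length W act Waff R C\<close>
      \<open>Delta = simple_affine_reflections act Waff R C\<close> by blast
  then show ?thesis
    using s unfolding Let_def \<open>Delta = simple_affine_reflections act Waff R C\<close> by blast
qed

end
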